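(* Let $U$ be a unitary operator on a Hilbert space $\mathcal{H}$. For $m\ge k$, let $\alpha:\{1,\dots,m\}\to\{1,\dots,k\}$ be a partition of the set $\{1,\dots,m\}$ (that is, a surjective map). If $\{A_1,\dots,A_{m-1}\}\subset\mathcal{K}(\mathcal{H})$ are compact operators on $\mathcal{H}$, then the ergodic average $$\frac{1}{N^{k}}\sum_{n_1,\dots,n_k=0}^{N-1}U^{n_{\alpha(1)}}A_1U^{n_{\alpha(2)}}\cdots U^{n_{\alpha(m-1)}}A_{m-1}U^{n_{\alpha(m)}}$$ converges in the weak operator topology as $N\to\infty$.
   Context: $\mathcal{K}(\mathcal{H})$ denotes the algebra of compact operators on the (complex) Hilbert space $\mathcal{H}$. A partition $\alpha:\{1,\dots,m\}\to\{1,\dots,k\}$ of a set of $m$ elements into $k$ parts is a surjective map, the parts being the preimages $\alpha^{-1}(\{j\})$, $j=1,\dots,k$. *)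

theory Defs
  imports "HOL-Analysis.Analysis"
begin

text \<open>
  The inner product is linear in the first and conjugate-linear in the second argument.
  Basing the class on \<^class>\<open>real_normed_vector\<close> makes the norm topology, boundedness and
  compactness of the library available; the last axiom fixes the norm as the one induced by the
  inner product.
\<close>

class complex_inner = real_normed_vector +
  fixes scaleC :: "complex \<Rightarrow> 'a \<Rightarrow> 'a"  (infixr "*\<^sub>C" 75)
    and cinner :: "'a \<Rightarrow> 'a \<Rightarrow> complex"
  assumes scaleC_add_right: "c *\<^sub>C (x + y) = c *\<^sub>C x + c *\<^sub>C y"
    and scaleC_add_left: "(c + d) *\<^sub>C x = c *\<^sub>C x + d *\<^sub>C x"
    and scaleC_scaleC: "c *\<^sub>C (d *\<^sub>C x) = (c * d) *\<^sub>C x"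
    and scaleC_of_real: "complex_of_real r *\<^sub>C x = r *\<^sub>R x"
    and cinner_commute: "cinner x y = cnj (cinner y x)"
    and cinner_add_left: "cinner (x + y) z = cinner x z + cinner y z"
    and cinner_scaleC_left: "cinner (c *\<^sub>C x) y = c * cinner x y"
    and norm_eq_sqrt_cinner: "norm x = sqrt (Re (cinner x x))"

class chilbert_space = complex_inner + complete_space
begin
subclass banach ..
end

text \<open>Positive definiteness is not an axiom since it follows from the norm being a norm.\<close>

lemma cinner_self: "cinner x x = complex_of_real ((norm x)\<^sup>2)"
proof -
  have "Im (cinner x x) = 0"
    by (metis cinner_commute complex_cnj_cancel_iff complex_In_mult_cnj_zero complex_is_Real_iff
        Reals_cnj_iff)
  moreover have "Re (cinner x x) \<ge> 0"
    by (metis norm_eq_sqrt_cinner norm_ge_zero real_sqrt_ge_0_iff)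
  then have "Re (cinner x x) = (norm x)\<^sup>2"
    by (simp add: norm_eq_sqrt_cinner)
  ultimately show ?thesis
    by (simp add: complex_eq_iff)
qed

instantiation complex :: chilbert_space
begin
definition "scaleC_complex = ((*) :: complex \<Rightarrow> complex \<Rightarrow> complex)"
definition "cinner_complex = (\<lambda>x y :: complex. x * cnj y)"
instance
  by standard
    (simp_all add: scaleC_complex_def cinner_complex_def algebra_simps scaleR_conv_of_real
      cmod_def power2_eq_square)
end

definition bounded_clinear :: "('a::complex_inner \<Rightarrow> 'a) \<Rightarrow> bool" where
  "bounded_clinear T \<longleftrightarrow> bounded_linear T \<and> (\<forall>c x. T (c *\<^sub>C x) = c *\<^sub>C T x)"

definition is_adjoint :: "('a::complex_inner \<Rightarrow> 'a) \<Rightarrow> ('a \<Rightarrow> 'a) \<Rightarrow> bool" where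
  "is_adjoint S T \<longleftrightarrow> (\<forall>x y. cinner (T x) y = cinner x (S y))"

definition unitary_operator :: "('a::chilbert_space \<Rightarrow> 'a) \<Rightarrow> bool" where
  "unitary_operator U \<longleftrightarrow>
     bounded_clinear U \<and>
     (\<exists>V. bounded_clinear V \<and> is_adjoint V U \<and> V \<circ> U = id \<and> U \<circ> V = id)"

definition compact_operator :: "('a::chilbert_space \<Rightarrow> 'a) \<Rightarrow> bool" where
  "compact_operator A \<longleftrightarrow> bounded_clinear A \<and> compact (closure (A ` cball 0 1))"

text \<open>
  The weak operator topology lives on the set of bounded complex-linear operators; it is the
  coarsest topology making all maps \<open>T \<mapsto> cinner (T x) y\<close> continuous.
\<close>

definition weak_operator_topology :: "('a::chilbert_space \<Rightarrow> 'a) topology" where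
  "weak_operator_topology =
     topology_generated_by {{T. bounded_clinear T \<and> cinner (T x) y \<in> W} | x y W. open W}"

lemma topspace_weak_operator_topology:
  "topspace weak_operator_topology = {T. bounded_clinear T}"
proof -
  have "{T. bounded_clinear T} = {T :: 'a \<Rightarrow> 'a. bounded_clinear T \<and> cinner (T 0) 0 \<in> UNIV}"
    by simp
  then show ?thesis
    unfolding weak_operator_topology_def topology_generated_by_topspace by blast
qed

lemma limitin_weak_operator_topology:
  "limitin weak_operator_topology F T net \<longleftrightarrow>
     bounded_clinear T \<and> (\<forall>\<^sub>F i in net. bounded_clinear (F i)) \<and>
     (\<forall>x y. ((\<lambda>i. cinner (F i x) y) \<longlongrightarrow> cinner (T x) y) net)"
  (is "?L \<longleftrightarrow> ?R")
proof
  assume L: ?L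
  have T: "bounded_clinear T"
    using L by (simp add: limitin_def topspace_weak_operator_topology)
  have ev: "\<forall>\<^sub>F i in net. F i \<in> S" if "openin weak_operator_topology S" "T \<in> S" for S
    using L that by (simp add: limitin_def)
  have "\<forall>\<^sub>F i in net. bounded_clinear (F i)"
    using ev[OF openin_topspace] T by (simp add: topspace_weak_operator_topology)
  moreover have "((\<lambda>i. cinner (F i x) y) \<longlongrightarrow> cinner (T x) y) net" for x y
  proof (rule topological_tendstoI)
    fix W assume W: "open W" "cinner (T x) y \<in> W"
    have "openin weak_operator_topology {T. bounded_clinear T \<and> cinner (T x) y \<in> W}"
      unfolding weak_operator_topology_def
      by (rule topology_generated_by_Basis) (use W in blast)
    from ev[OF this] show "\<forall>\<^sub>F i in net. cinner (F i x) y \<in> W"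
      using T W by (auto elim: eventually_mono)
  qed
  ultimately show ?R using T by blast
next
  assume R: ?R
  have "\<forall>\<^sub>F i in net. F i \<in> S" if "openin weak_operator_topology S" "T \<in> S" for S
  proof -
    have "generate_topology_on {{T. bounded_clinear T \<and> cinner (T x) y \<in> W} | x y W. open W} S"
      using that(1) by (simp add: weak_operator_topology_def openin_topology_generated_by_iff)
    then show ?thesis using that(2)
    proof (induction rule: generate_topology_on.induct)
      case Empty
      then show ?case by simp
    next
      case (Int a b)
      then show ?case by (simp add: eventually_conj_iff)
    next
      case (UN K)
      then obtain k where k: "k \<in> K" "T \<in> k" by blast
      from UN.IH[OF this] show ?case
        using k by (auto elim: eventually_mono)
    next
      case (Basis s)
      then obtain x y W where s: "s = {T. bounded_clinear T \<and> cinner (T x) y \<in> W}" "open W"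
        by blast
      have "\<forall>\<^sub>F i in net. cinner (F i x) y \<in> W"
        using R s Basis.prems by (intro topological_tendstoD) auto
      with R s show ?case by (simp add: eventually_conj_iff)
    qed
  qed
  with R show ?L
    by (simp add: limitin_def topspace_weak_operator_topology)
qed

text \<open>
  \<open>entangled_word U A \<alpha> n j\<close> is the operator
  $U^{n_{\alpha(1)}} A_1 U^{n_{\alpha(2)}} \cdots A_j U^{n_{\alpha(j+1)}}$,
  so that the word with \<open>m\<close> powers of \<open>U\<close> has last argument \<open>m - 1\<close>.
\<close>

primrec entangled_word ::
  "('a \<Rightarrow> 'a) \<Rightarrow> (nat \<Rightarrow> 'a \<Rightarrow> 'a) \<Rightarrow> (nat \<Rightarrow> nat) \<Rightarrow> (nat \<Rightarrow> nat) \<Rightarrow> nat \<Rightarrow> 'a \<Rightarrow> 'a" where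
  "entangled_word U A \<alpha> n 0 = U ^^ n (\<alpha> 1)"
| "entangled_word U A \<alpha> n (Suc j) =
     entangled_word U A \<alpha> n j \<circ> A (Suc j) \<circ> U ^^ n (\<alpha> (Suc (Suc j)))"

definition ergodic_average ::
  "('a::chilbert_space \<Rightarrow> 'a) \<Rightarrow> (nat \<Rightarrow> 'a \<Rightarrow> 'a) \<Rightarrow> (nat \<Rightarrow> nat) \<Rightarrow> nat \<Rightarrow> nat \<Rightarrow> nat \<Rightarrow> 'a \<Rightarrow> 'a"
  where
  "ergodic_average U A \<alpha> m k N = (\<lambda>x.
     (1 / of_nat N ^ k) *\<^sub>C
     (\<Sum>n \<in> {1..k} \<rightarrow>\<^sub>E {0..<N}. entangled_word U A \<alpha> n (m - 1) x))"

end

theory Submission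
  imports Defs "HOL-Computational_Algebra.Polynomial"
begin

text \<open>
  Approximating each compact \<open>A\<^sub>i\<close> in norm by a finite-rank operator turns a matrix coefficient of the
  average into finite sums of products, over \<open>j = 1..k\<close>, of Cesaro means of sequences
  \<open>\<Prod>\<^sub>l \<langle>U^n u\<^sub>l, v\<^sub>l\<rangle>\<close>. Such a product is a matrix coefficient of a tensor power of \<open>U\<close>, so its means
  converge by von Neumann's mean ergodic theorem. In place of the tensor power, only the Gram kernel of
  the vectors involved is used; it is positive semidefinite by the Schur product theorem. The ergodic
  theorem itself is proved for a shift-invariant seminorm on polynomials: the seminorms of the averages
  tend to their infimum, and the parallelogram law makes the averages Cauchy. The limit form is bounded
  and is represented by an operator thanks to the Riesz representation theorem.
\<close>

section \<open>Complex inner products\<close>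

lemma scaleC_zero_left [simp]: "0 *\<^sub>C (x::'a::complex_inner) = 0"
  using scaleC_of_real[of 0 x] by simp

lemma scaleC_zero_right [simp]: "c *\<^sub>C (0::'a::complex_inner) = 0"
  using scaleC_add_right[of c "0::'a" 0] by simp

lemma scaleC_sum_right: "c *\<^sub>C (\<Sum>i\<in>I. f i) = (\<Sum>i\<in>I. c *\<^sub>C (f i :: 'a::complex_inner))"
  by (induction I rule: infinite_finite_induct) (auto simp: scaleC_add_right)

lemma scaleR_eq_scaleC: "r *\<^sub>R (x::'a::complex_inner) = complex_of_real r *\<^sub>C x"
  by (simp add: scaleC_of_real)

lemma cinner_scaleR_left: "cinner (r *\<^sub>R x) y = of_real r * cinner x y"
  by (simp add: scaleR_eq_scaleC cinner_scaleC_left)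

lemma cinner_zero_left [simp]: "cinner 0 (y::'a::complex_inner) = 0"
  using cinner_add_left[of 0 0 y] by simp

lemma cinner_minus_left: "cinner (- x) (y::'a::complex_inner) = - cinner x y"
  using cinner_add_left[of x "- x" y] by (simp add: add_eq_0_iff)

lemma cinner_diff_left: "cinner (x - y) (z::'a::complex_inner) = cinner x z - cinner y z"
  using cinner_add_left[of x "- y" z] by (simp add: cinner_minus_left)

lemma cinner_sum_left: "cinner (\<Sum>i\<in>I. f i) (y::'a::complex_inner) = (\<Sum>i\<in>I. cinner (f i) y)"
  by (induction I rule: infinite_finite_induct) (auto simp: cinner_add_left)

lemma cinner_add_right: "cinner (x::'a::complex_inner) (y + z) = cinner x y + cinner x z"
  by (metis cinner_add_left cinner_commute complex_cnj_add)

lemma cinner_diff_right: "cinner (x::'a::complex_inner) (y - z) = cinner x y - cinner x z"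
  by (metis cinner_diff_left cinner_commute complex_cnj_diff)

lemma cinner_scaleC_right: "cinner (x::'a::complex_inner) (c *\<^sub>C y) = cnj c * cinner x y"
  by (metis cinner_scaleC_left cinner_commute complex_cnj_mult)

lemma cinner_scaleR_right: "cinner (x::'a::complex_inner) (r *\<^sub>R y) = of_real r * cinner x y"
  by (simp add: scaleR_eq_scaleC cinner_scaleC_right)

lemma cinner_zero_right [simp]: "cinner (x::'a::complex_inner) 0 = 0"
  by (metis cinner_commute cinner_zero_left complex_cnj_zero)

lemma cinner_sum_right: "cinner (x::'a::complex_inner) (\<Sum>i\<in>I. f i) = (\<Sum>i\<in>I. cinner x (f i))"
  by (induction I rule: infinite_finite_induct) (auto simp: cinner_add_right)

lemma norm_sq_eq_Re_cinner: "(norm (x::'a::complex_inner))\<^sup>2 = Re (cinner x x)"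
  by (simp add: cinner_self)

lemma norm_scaleC [simp]: "norm (c *\<^sub>C (x::'a::complex_inner)) = cmod c * norm x"
proof -
  have "complex_of_real ((norm (c *\<^sub>C x))\<^sup>2) = c * cnj c * cinner x x"
    by (simp add: cinner_self[symmetric] cinner_scaleC_left cinner_scaleC_right
        del: of_real_power)
  also have "\<dots> = of_real ((cmod c * norm x)\<^sup>2)"
    by (simp only: cinner_self complex_norm_square[symmetric] of_real_mult[symmetric]
        power_mult_distrib)
  finally have "complex_of_real ((norm (c *\<^sub>C x))\<^sup>2) = of_real ((cmod c * norm x)\<^sup>2)" .
  then have "(norm (c *\<^sub>C x))\<^sup>2 = (cmod c * norm x)\<^sup>2"
    using of_real_eq_iff by blast
  then show ?thesis
    by (metis norm_ge_zero power2_eq_imp_eq mult_nonneg_nonneg)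
qed

lemma norm_add_sq:
  "(norm (x + y))\<^sup>2 = (norm x)\<^sup>2 + 2 * Re (cinner x y) + (norm (y::'a::complex_inner))\<^sup>2"
proof -
  have "Re (cinner y x) = Re (cinner x y)"
    by (subst cinner_commute) simp
  then show ?thesis
    by (simp add: norm_sq_eq_Re_cinner cinner_add_left cinner_add_right)
qed

lemma norm_diff_sq:
  "(norm (x - y))\<^sup>2 = (norm x)\<^sup>2 - 2 * Re (cinner x y) + (norm (y::'a::complex_inner))\<^sup>2"
proof -
  have "Re (cinner y x) = Re (cinner x y)"
    by (subst cinner_commute) simp
  then show ?thesis
    by (simp add: norm_sq_eq_Re_cinner cinner_diff_left cinner_diff_right)
qed

lemma parallelogram_law:
  "(norm (x - y))\<^sup>2 + (norm (x + y))\<^sup>2 = 2 * (norm x)\<^sup>2 + 2 * (norm (y::'a::complex_inner))\<^sup>2"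
  by (simp add: norm_add_sq norm_diff_sq)

lemma Cauchy_Schwarz_cinner: "cmod (cinner x y) \<le> norm x * norm (y::'a::complex_inner)"
proof (cases "y = 0")
  case False
  \<comment> \<open>\<open>s *\<^sub>C y\<close> is the orthogonal projection of \<open>x\<close> to
    the line of \<open>y\<close>. Its squared distance from \<open>x\<close> is nonnegative, which
    is the inequality after clearing the denominator.\<close>
  define s where "s = cinner x y / of_real ((norm y)\<^sup>2)"
  have "0 \<le> (norm (x - s *\<^sub>C y))\<^sup>2" by simp
  also have "\<dots> = (norm x)\<^sup>2 - 2 * Re (cnj s * cinner x y) + (cmod s)\<^sup>2 * (norm y)\<^sup>2"
    by (simp add: norm_diff_sq cinner_scaleC_right power_mult_distrib)
  also have "cnj s * cinner x y = of_real ((cmod (cinner x y))\<^sup>2 / (norm y)\<^sup>2)"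
    by (simp add: s_def mult.commute complex_norm_square[symmetric] del: of_real_power)
  also have "(cmod s)\<^sup>2 * (norm y)\<^sup>2 = (cmod (cinner x y))\<^sup>2 / (norm y)\<^sup>2"
    using False by (simp add: s_def norm_divide norm_power power_divide power2_eq_square norm_mult)
  finally have "(cmod (cinner x y))\<^sup>2 / (norm y)\<^sup>2 \<le> (norm x)\<^sup>2"
    by simp
  then have "(cmod (cinner x y))\<^sup>2 \<le> (norm x * norm y)\<^sup>2"
    using False by (simp add: divide_le_eq power_mult_distrib)
  then show ?thesis
    by (rule power2_le_imp_le) simp
qed simp

section \<open>The Riesz representation theorem\<close>

text \<open>If \<open>f\<close> is the pairing with \<open>u\<close>, then \<open>J x\<close> below
  equals the squared distance of \<open>x\<close> and \<open>u\<close> up to a constant. Hence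
  \<open>u\<close> is sought as the minimizer of \<open>J\<close>. It exists by completeness, and
  the vanishing first variation of \<open>J\<close> there identifies \<open>f\<close>.\<close>

theorem Riesz_representation:
  fixes f :: "'a::chilbert_space \<Rightarrow> complex"
  assumes add: "\<And>x y. f (x + y) = f x + f y"
    and scale: "\<And>c x. f (c *\<^sub>C x) = c * f x"
    and bound: "\<And>x. cmod (f x) \<le> M * norm x"
  shows "\<exists>u. \<forall>x. f x = cinner x u"
proof -
  define J where "J x = (norm x)\<^sup>2 - 2 * Re (f x)" for x
  have J_lower: "- (M\<^sup>2) \<le> J x" for x
  proof -
    have "Re (f x) \<le> M * norm x"
      using bound[of x] complex_Re_le_cmod[of "f x"] by linarith
    moreover have "0 \<le> (norm x - M)\<^sup>2" by simp
    ultimately show ?thesis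
      by (simp add: J_def power2_diff algebra_simps)
  qed
  define I where "I = Inf (range J)"
  have bdd: "bdd_below (range J)"
    using J_lower by (auto intro!: bdd_belowI2)
  have I_le: "I \<le> J x" for x
    unfolding I_def using bdd by (rule cINF_lower) simp
  have "\<exists>x. J x < I + 1 / Suc n" for n
    using cInf_lessD[of "range J" "I + 1 / Suc n"] by (auto simp: I_def)
  then obtain X where X: "\<And>n. J (X n) < I + 1 / Suc n" by metis
  have scaleR: "f (r *\<^sub>R x) = of_real r * f x" for r x
    by (simp add: scaleR_eq_scaleC scale)
  \<comment> \<open>\<open>J\<close> at the midpoint of \<open>x\<close> and \<open>y\<close> is at
    least \<open>I\<close>. With the parallelogram law this forces near-minimizers to be close to
    each other.\<close>
  have close: "(norm (x - y))\<^sup>2 \<le> 2 * (J x - I) + 2 * (J y - I)" for x y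
  proof -
    have "4 * J ((1/2) *\<^sub>R (x + y)) = (norm (x + y))\<^sup>2 - 4 * Re (f x + f y)"
      by (simp add: J_def scaleR add power_divide power2_eq_square del: scaleR_add_right) argo
    then have "4 * I \<le> (norm (x + y))\<^sup>2 - 4 * Re (f x + f y)"
      using I_le[of "(1/2) *\<^sub>R (x + y)"] by linarith
    then show ?thesis
      using parallelogram_law[of x y] by (simp add: J_def)
  qed
  have "Cauchy X"
  proof (rule metric_CauchyI)
    fix e :: real assume e: "0 < e"
    have "0 < e\<^sup>2 / 4" using e by simp
    from reals_Archimedean[OF this] obtain n0 where n0: "1 / Suc n0 < e\<^sup>2 / 4"
      unfolding inverse_eq_divide by blast
    have near: "J (X p) < I + e\<^sup>2 / 4" if "p \<ge> n0" for p
    proof -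
      note X[of p]
      also have "I + 1 / real (Suc p) \<le> I + 1 / real (Suc n0)"
        using that by (intro add_left_mono frac_le) simp_all
      also have "\<dots> < I + e\<^sup>2 / 4"
        using n0 by (rule add_strict_left_mono)
      finally show ?thesis .
    qed
    have "dist (X p) (X q) < e" if pq: "p \<ge> n0" "q \<ge> n0" for p q
    proof -
      have "(norm (X p - X q))\<^sup>2 < e\<^sup>2"
        using close[of "X p" "X q"] near[OF pq(1)] near[OF pq(2)] by argo
      then have "norm (X p - X q) < e"
        by (rule power2_less_imp_less) (rule less_imp_le[OF e])
      then show ?thesis by (simp add: dist_norm)
    qed
    then show "\<exists>n0. \<forall>p\<ge>n0. \<forall>q\<ge>n0. dist (X p) (X q) < e" by blast
  qed
  then obtain u where u: "X \<longlonglongrightarrow> u"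
    by (blast dest: Cauchy_convergent convergentD)
  have "bounded_linear f"
    by (rule bounded_linear_intro[where K = M])
      (auto simp: add scaleR scaleR_conv_of_real mult.commute bound)
  note this[THEN bounded_linear.tendsto, OF u]
  then have "(\<lambda>n. J (X n)) \<longlonglongrightarrow> J u"
    unfolding J_def by (intro tendsto_diff tendsto_power tendsto_norm tendsto_mult tendsto_const
        tendsto_Re u)
  moreover have "(\<lambda>n. I + 1 / Suc n) \<longlonglongrightarrow> I + 0"
    by (rule tendsto_add[OF tendsto_const LIMSEQ_inverse_real_of_nat[unfolded inverse_eq_divide]])
  ultimately have "J u \<le> I + 0"
    by (rule LIMSEQ_le) (use X less_imp_le in blast)
  then have min: "J u \<le> J x" for x
    using I_le[of x] by linarith
  have Re_eq: "Re (f x) = Re (cinner x u)" for x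
  proof -
    \<comment> \<open>\<open>d\<close> is half the derivative of \<open>J\<close> at
      \<open>u\<close> in direction \<open>x\<close>, and \<open>s\<close> is a step against it. The
      summand 1 keeps the denominator positive for \<open>x = 0\<close>. The change of
      \<open>J\<close> is then at most \<open>s * d\<close>, a nonpositive multiple of the square of
      \<open>d\<close>, so \<open>d = 0\<close>.\<close>
    define d where "d = Re (cinner u x) - Re (f x)"
    define s where "s = - d / ((norm x)\<^sup>2 + 1)"
    have "J (u + s *\<^sub>R x) = J u + 2 * s * d + s\<^sup>2 * (norm x)\<^sup>2"
      by (simp add: J_def norm_add_sq cinner_scaleR_right add scaleR d_def power_mult_distrib
          algebra_simps)
    then have "0 \<le> 2 * s * d + s\<^sup>2 * (norm x)\<^sup>2"
      using min[of "u + s *\<^sub>R x"] by linarith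
    also have "\<dots> \<le> 2 * s * d + s\<^sup>2 * ((norm x)\<^sup>2 + 1)"
      by (simp add: mult_left_mono)
    also have "s\<^sup>2 * ((norm x)\<^sup>2 + 1) = - (s * d)"
    proof -
      have "s * ((norm x)\<^sup>2 + 1) = - d"
        unfolding s_def by (simp add: add_nonneg_eq_0_iff)
      then show ?thesis by (simp add: power2_eq_square mult.assoc)
    qed
    finally have "0 \<le> s * d" by (simp add: mult.commute)
    moreover have pos: "0 < (norm x)\<^sup>2 + 1"
      by (rule add_nonneg_pos[OF zero_le_power2 zero_less_one])
    moreover have "s * d = - ((d * d) / ((norm x)\<^sup>2 + 1))"
      by (simp add: s_def)
    ultimately have "d * d \<le> 0"
      by (metis divide_pos_pos neg_0_le_iff_le not_less)
    then have "d = 0"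
      by (metis mult_eq_0_iff order_antisym zero_le_square)
    then have "Re (f x) = Re (cinner u x)" by (simp add: d_def)
    then show ?thesis by (subst cinner_commute) simp
  qed
  have "f x = cinner x u" for x
  proof (rule complex_eqI)
    \<comment> \<open>Replacing \<open>x\<close> by i times \<open>x\<close> turns the imaginary
      part into minus a real part.\<close>
    show "Im (f x) = Im (cinner x u)"
      using Re_eq[of "\<i> *\<^sub>C x"] by (simp add: scale cinner_scaleC_left)
  qed (rule Re_eq)
  then show ?thesis by blast
qed

section \<open>Finite-rank approximation of compact operators\<close>

definition orthonormal :: "'a::complex_inner set \<Rightarrow> bool" where
  "orthonormal E \<longleftrightarrow> (\<forall>x\<in>E. \<forall>y\<in>E. cinner x y = (if x = y then 1 else 0))"

lemma cinner_expansion: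
  assumes "finite E" "orthonormal E" "e \<in> E"
  shows "cinner (\<Sum>d\<in>E. c d *\<^sub>C d) e = c e"
proof -
  have "cinner (\<Sum>d\<in>E. c d *\<^sub>C d) e = (\<Sum>d\<in>E. if d = e then c d else 0)"
    unfolding cinner_sum_left using assms
    by (intro sum.cong) (auto simp: cinner_scaleC_left orthonormal_def)
  then show ?thesis using assms by simp
qed

text \<open>Membership in the span of \<open>E\<close> is expressed by equality with the own Fourier
  expansion. In the induction, the new vector minus its projection is normalized and adjoined,
  unless it is zero.\<close>

lemma Gram_Schmidt:
  fixes S :: "'a::complex_inner set"
  assumes "finite S"
  shows "\<exists>E. finite E \<and> orthonormal E \<and> (\<forall>s\<in>S. s = (\<Sum>e\<in>E. cinner s e *\<^sub>C e))"
  using assms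
proof induction
  case empty
  show ?case by (rule exI[of _ "{}"]) (auto simp: orthonormal_def)
next
  case (insert s S)
  then obtain E where E: "finite E" "orthonormal E"
    and S: "\<And>t. t \<in> S \<Longrightarrow> t = (\<Sum>e\<in>E. cinner t e *\<^sub>C e)" by blast
  define r where "r = s - (\<Sum>e\<in>E. cinner s e *\<^sub>C e)"
  show ?case
  proof (cases "r = 0")
    case True
    then show ?thesis using E S by (intro exI[of _ E]) (auto simp: r_def)
  next
    case False
    define d where "d = (1 / norm r) *\<^sub>R r"
    have r_perp: "cinner r e = 0" if "e \<in> E" for e
      using cinner_expansion[OF E that] by (simp add: r_def cinner_diff_left)
    have d_perp: "cinner d e = 0" "cinner e d = 0" if "e \<in> E" for e
      using r_perp[OF that] cinner_commute[of e r]
      by (simp_all add: d_def cinner_scaleR_left cinner_scaleR_right)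
    have dd: "cinner d d = 1"
      using False by (simp add: d_def cinner_self)
    have notin: "d \<notin> E" using d_perp dd by fastforce
    have "orthonormal (insert d E)"
      using E(2) d_perp dd notin by (auto simp: orthonormal_def)
    moreover have "t = (\<Sum>e\<in>insert d E. cinner t e *\<^sub>C e)" if "t \<in> S" for t
    proof -
      have "cinner t d = 0"
        by (subst S[OF that]) (simp add: cinner_sum_left cinner_scaleC_left d_perp)
      then show ?thesis using S[OF that] E notin by simp
    qed
    moreover have "s = (\<Sum>e\<in>insert d E. cinner s e *\<^sub>C e)"
    proof -
      have s: "s = r + (\<Sum>e\<in>E. cinner s e *\<^sub>C e)" by (simp add: r_def)
      have "cinner s d = cinner r d"
        by (subst s) (simp add: cinner_add_left cinner_sum_left cinner_scaleC_left d_perp)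
      also have "\<dots> = of_real (norm r)"
        using False by (simp add: d_def cinner_scaleR_right cinner_self power2_eq_square)
      finally have "cinner s d *\<^sub>C d = r"
        using False by (simp add: scaleC_of_real d_def)
      then show ?thesis using s E notin by simp
    qed
    ultimately show ?thesis
      using E by (intro exI[of _ "insert d E"]) auto
  qed
qed

text \<open>The residual of the projection is orthogonal to the span of \<open>E\<close>, which
  contains \<open>s\<close>, so Pythagoras applies.\<close>

lemma norm_diff_projection_le:
  assumes E: "finite E" "orthonormal E" and s: "s = (\<Sum>e\<in>E. cinner s e *\<^sub>C e)"
  shows "norm (x - (\<Sum>e\<in>E. cinner x e *\<^sub>C e)) \<le> norm (x - s)"
proof -
  define P where "P = (\<Sum>e\<in>E. cinner x e *\<^sub>C e)"
  have perp: "cinner (x - P) e = 0" if "e \<in> E" for e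
    using cinner_expansion[OF E that] by (simp add: P_def cinner_diff_left)
  have "cinner (x - P) P = 0" "cinner (x - P) s = 0"
  proof -
    show "cinner (x - P) P = 0"
      by (subst (2) P_def) (simp add: cinner_sum_right cinner_scaleC_right perp)
    show "cinner (x - P) s = 0"
      by (subst s) (simp add: cinner_sum_right cinner_scaleC_right perp)
  qed
  then have "(norm (x - s))\<^sup>2 = (norm (x - P))\<^sup>2 + (norm (P - s))\<^sup>2"
    using norm_add_sq[of "x - P" "P - s"] by (simp add: cinner_diff_right)
  then have "(norm (x - P))\<^sup>2 \<le> (norm (x - s))\<^sup>2" by simp
  then show ?thesis unfolding P_def by (rule power2_le_imp_le) simp
qed

text \<open>The image of the unit ball has a finite \<epsilon>-net. Composing \<open>A\<close> with
  the projection onto the span of the net moves no image of a unit vector by more than \<epsilon>.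
  The coefficients of the projection are bounded functionals of \<open>x\<close>, and the vectors
  \<open>u e\<close> represent them by Riesz.\<close>

lemma compact_operator_finite_rank_approximation:
  fixes A :: "'a::chilbert_space \<Rightarrow> 'a"
  assumes A: "compact_operator A" and "0 < \<epsilon>"
  shows "\<exists>E u. finite E \<and> (\<forall>x. norm (A x - (\<Sum>e\<in>E. cinner x (u e) *\<^sub>C e)) \<le> \<epsilon> * norm x)"
proof -
  have lin: "bounded_linear A" and scaleC: "\<And>c x. A (c *\<^sub>C x) = c *\<^sub>C A x"
    and cpt: "compact (closure (A ` cball 0 1))"
    using A by (auto simp: compact_operator_def bounded_clinear_def)
  interpret bounded_linear A by fact
  obtain S where S: "finite S" "closure (A ` cball 0 1) \<subseteq> (\<Union>s\<in>S. ball s \<epsilon>)"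
    using compactE_image[OF cpt, of UNIV "\<lambda>s. ball s \<epsilon>"] \<open>0 < \<epsilon>\<close> 
    by (metis (no_types, lifting) UNIV_I UN_iff centre_in_ball open_ball subsetI)
  obtain E where E: "finite E" "orthonormal E"
    and ES: "\<And>s. s \<in> S \<Longrightarrow> s = (\<Sum>e\<in>E. cinner s e *\<^sub>C e)"
    using Gram_Schmidt[OF S(1)] by blast
  obtain M where M: "\<And>x. norm (A x) \<le> norm x * M" using bounded by blast
  have "\<exists>v. \<forall>x. cinner (A x) e = cinner x v" for e
  proof (rule Riesz_representation[where M = "M * norm e"])
    show "cmod (cinner (A x) e) \<le> M * norm e * norm x" for x
      using Cauchy_Schwarz_cinner[of "A x" e] mult_right_mono[OF M[of x], of "norm e"]
      by (simp add: mult.commute mult.left_commute)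
  qed (simp_all add: add scaleC cinner_add_left cinner_scaleC_left)
  then obtain u where u: "\<And>x e. cinner (A x) e = cinner x (u e)" by metis
  have "norm (A x - (\<Sum>e\<in>E. cinner x (u e) *\<^sub>C e)) \<le> \<epsilon> * norm x" for x
  proof (cases "x = 0")
    case False
    \<comment> \<open>The net controls only the image of the unit ball, so \<open>x\<close> is
      normalized first.\<close>
    define z where "z = (1 / norm x) *\<^sub>R x"
    have "A z \<in> closure (A ` cball 0 1)"
      using False by (auto simp: z_def intro!: subsetD[OF closure_subset] imageI)
    then obtain s where "s \<in> S" and s: "norm (A z - s) < \<epsilon>"
      using S(2) by (auto simp: dist_norm norm_minus_commute)
    define R where "R = A z - (\<Sum>e\<in>E. cinner (A z) e *\<^sub>C e)"
    have R_le: "norm R \<le> \<epsilon>"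
      unfolding R_def using norm_diff_projection_le[OF E ES[OF \<open>s \<in> S\<close>], of "A z"] s by linarith
    have "A x - (\<Sum>e\<in>E. cinner x (u e) *\<^sub>C e) = norm x *\<^sub>R R"
    proof -
      have x: "x = norm x *\<^sub>R z" using False by (simp add: z_def)
      have "(\<Sum>e\<in>E. cinner x (u e) *\<^sub>C e) = norm x *\<^sub>R (\<Sum>e\<in>E. cinner (A z) e *\<^sub>C e)"
        by (subst x) (simp add: u cinner_scaleR_left scaleR_eq_scaleC scaleC_sum_right
            scaleC_scaleC cinner_scaleC_left)
      moreover have "A x = norm x *\<^sub>R A z" by (subst x) (simp only: scaleR)
      ultimately show ?thesis by (simp add: scaleR_diff_right R_def)
    qed
    then show ?thesis
      using mult_right_mono[OF R_le norm_ge_zero, of x] by (simp add: mult.commute)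
  qed (simp add: zero)
  then show ?thesis using E(1) by (intro exI conjI allI)
qed

section \<open>Positive semidefinite kernels\<close>

text \<open>Only the real part of the form is constrained, so Hermitian symmetry is not implied. It
  is assumed separately where the form has to be expanded around one index.\<close>

definition psd_on :: "'i set \<Rightarrow> ('i \<Rightarrow> 'i \<Rightarrow> complex) \<Rightarrow> bool" where
  "psd_on F K \<longleftrightarrow> (\<forall>c. 0 \<le> Re (\<Sum>i\<in>F. \<Sum>j\<in>F. c i * cnj (c j) * K i j))"

lemma psd_onD: "psd_on F K \<Longrightarrow> 0 \<le> Re (\<Sum>i\<in>F. \<Sum>j\<in>F. c i * cnj (c j) * K i j)"
  by (simp add: psd_on_def)

lemma double_sum_insert_zero:
  fixes f :: "'i \<Rightarrow> 'i \<Rightarrow> 'b::comm_monoid_add"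
  assumes "finite F" "a \<notin> F" "\<And>i. f i a = 0" "\<And>j. f a j = 0"
  shows "(\<Sum>i\<in>insert a F. \<Sum>j\<in>insert a F. f i j) = (\<Sum>i\<in>F. \<Sum>j\<in>F. f i j)"
  using assms by simp

lemma psd_on_insertD:
  assumes "finite F" "a \<notin> F" "psd_on (insert a F) K"
  shows "psd_on F K"
  unfolding psd_on_def
proof
  fix c :: "'a \<Rightarrow> complex"
  let ?c = "c(a := 0)"
  have "0 \<le> Re (\<Sum>i\<in>insert a F. \<Sum>j\<in>insert a F. ?c i * cnj (?c j) * K i j)"
    using assms(3) by (rule psd_onD)
  also have "(\<Sum>i\<in>insert a F. \<Sum>j\<in>insert a F. ?c i * cnj (?c j) * K i j)
      = (\<Sum>i\<in>F. \<Sum>j\<in>F. ?c i * cnj (?c j) * K i j)"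
    using assms by (intro double_sum_insert_zero) auto
  also have "\<dots> = (\<Sum>i\<in>F. \<Sum>j\<in>F. c i * cnj (c j) * K i j)"
    using assms(2) by (intro sum.cong refl) auto
  finally show "0 \<le> Re (\<Sum>i\<in>F. \<Sum>j\<in>F. c i * cnj (c j) * K i j)" .
qed

text \<open>
  Projecting all vectors to the orthogonal complement of one of them, \<open>w a\<close>, splits off a rank-one
  kernel and makes the row and column \<open>a\<close> of the remaining Gram matrix vanish.
\<close>

lemma psd_on_mult_Gram:
  fixes w :: "'i \<Rightarrow> 'a::complex_inner"
  assumes "finite F" "psd_on F K"
  shows "psd_on F (\<lambda>i j. K i j * cinner (w i) (w j))"
  using assms
proof (induction F arbitrary: w)
  case empty
  then show ?case by (simp add: psd_on_def)
next
  case (insert a F)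
  define e where "e = inverse (norm (w a)) *\<^sub>R w a"
  define b where "b i = cinner (w i) e" for i
  define v where "v i = w i - b i *\<^sub>C e" for i
  \<comment> \<open>For \<open>w a = 0\<close> the vector \<open>e\<close> is zero rather than a
    unit vector. The factor \<open>cinner y e\<close> makes the identity true in this case
    too.\<close>
  have ee: "x * cinner y e * cinner e e = x * cinner y e" for x y
    by (cases "w a = 0") (simp_all add: e_def cinner_self)
  have "b a = of_real (norm (w a))"
    by (cases "w a = 0")
      (simp_all add: b_def e_def cinner_scaleR_right cinner_self power2_eq_square)
  then have "b a *\<^sub>C e = w a"
    by (cases "w a = 0") (simp_all add: e_def scaleC_of_real)
  then have v_a: "v a = 0" by (simp add: v_def)
  have split: "cinner (w i) (w j) = cinner (v i) (v j) + b i * cnj (b j)" for i j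
    using ee[of "cnj (b j)" "w i"] cinner_commute[of e "w j"]
    by (simp add: v_def cinner_diff_left cinner_diff_right cinner_scaleC_left cinner_scaleC_right
        b_def algebra_simps)
  have "psd_on F (\<lambda>i j. K i j * cinner (v i) (v j))"
    using insert.IH psd_on_insertD[OF insert.hyps insert.prems] .
  show ?case
    unfolding psd_on_def
  proof
    fix c :: "'i \<Rightarrow> complex"
    \<comment> \<open>The rank-one part is absorbed into the coefficients, now
      \<open>c i * b i\<close>, so positivity of \<open>K\<close> itself covers it. The other part
      lives on \<open>F\<close> and is left to the induction hypothesis.\<close>
    have "(\<Sum>i\<in>insert a F. \<Sum>j\<in>insert a F. c i * cnj (c j) * (K i j * cinner (w i) (w j)))
      = (\<Sum>i\<in>insert a F. \<Sum>j\<in>insert a F. c i * cnj (c j) * (K i j * cinner (v i) (v j)))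
        + (\<Sum>i\<in>insert a F. \<Sum>j\<in>insert a F. (c i * b i) * cnj (c j * b j) * K i j)"
      unfolding sum.distrib[symmetric] by (intro sum.cong refl) (simp add: split algebra_simps)
    also have "(\<Sum>i\<in>insert a F. \<Sum>j\<in>insert a F. c i * cnj (c j) * (K i j * cinner (v i) (v j)))
        = (\<Sum>i\<in>F. \<Sum>j\<in>F. c i * cnj (c j) * (K i j * cinner (v i) (v j)))"
      using insert.hyps by (intro double_sum_insert_zero) (auto simp: v_a)
    finally show "0 \<le> Re (\<Sum>i\<in>insert a F. \<Sum>j\<in>insert a F.
        c i * cnj (c j) * (K i j * cinner (w i) (w j)))"
      using psd_onD[OF \<open>psd_on F (\<lambda>i j. K i j * cinner (v i) (v j))\<close>, of c]
        psd_onD[OF insert.prems, of "\<lambda>i. c i * b i"] by simp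
  qed
qed

text \<open>Giving the index \<open>q\<close> the coefficient \<open>s\<close> yields a quadratic in
  \<open>s\<close> that is nonnegative for every \<open>s\<close>; one suitable \<open>s\<close>
  gives the bound. The summand 1 spares a case distinction on whether \<open>K q q\<close>
  vanishes.\<close>

lemma psd_on_Cauchy_Schwarz:
  assumes F: "finite F" "q \<notin> F" and psd: "psd_on (insert q F) K"
    and herm: "\<And>i j. K i j = cnj (K j i)"
  shows "(cmod (\<Sum>i\<in>F. c i * K i q))\<^sup>2
    \<le> (Re (K q q) + 1) * Re (\<Sum>i\<in>F. \<Sum>j\<in>F. c i * cnj (c j) * K i j)"
proof -
  define S where "S = (\<Sum>i\<in>F. c i * K i q)"
  define R where "R = Re (\<Sum>i\<in>F. \<Sum>j\<in>F. c i * cnj (c j) * K i j)"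
  define r where "r = Re (K q q)"
  have ge: "0 \<le> R + 2 * Re (cnj s * S) + (cmod s)\<^sup>2 * r" for s
  proof -
    let ?c = "c(q := s)"
    have 1: "(\<Sum>i\<in>F. ?c i * K i q) = S"
      unfolding S_def using F by (intro sum.cong) auto
    have 2: "(\<Sum>j\<in>F. cnj (?c j) * K q j) = cnj S"
      unfolding S_def cnj_sum
    proof (intro sum.cong refl)
      fix j assume "j \<in> F"
      then have "?c j = c j" using F by auto
      then show "cnj (?c j) * K q j = cnj (c j * K j q)"
        by (simp only: complex_cnj_mult herm[of q j])
    qed
    have 3: "(\<Sum>i\<in>F. \<Sum>j\<in>F. ?c i * cnj (?c j) * K i j) = (\<Sum>i\<in>F. \<Sum>j\<in>F. c i * cnj (c j) * K i j)"
      using F by (intro sum.cong refl) auto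
    have "(\<Sum>i\<in>insert q F. \<Sum>j\<in>insert q F. ?c i * cnj (?c j) * K i j)
      = s * cnj s * K q q + s * (\<Sum>j\<in>F. cnj (?c j) * K q j) + (cnj s * (\<Sum>i\<in>F. ?c i * K i q)
        + (\<Sum>i\<in>F. \<Sum>j\<in>F. ?c i * cnj (?c j) * K i j))"
      using F by (simp add: sum.distrib sum_distrib_left mult_ac del: fun_upd_apply)
        (simp add: mult_ac)
    also have "\<dots> = of_real ((cmod s)\<^sup>2) * K q q + s * cnj S + (cnj s * S
        + (\<Sum>i\<in>F. \<Sum>j\<in>F. c i * cnj (c j) * K i j))"
      by (simp only: 1 2 3 complex_norm_square)
    finally have "Re (\<Sum>i\<in>insert q F. \<Sum>j\<in>insert q F. ?c i * cnj (?c j) * K i j)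
        = (cmod s)\<^sup>2 * r + 2 * Re (cnj s * S) + R"
      by (simp add: r_def R_def)
    with psd_onD[OF psd, of ?c] show ?thesis by linarith
  qed
  have "0 \<le> r"
  proof -
    \<comment> \<open>The indices in \<open>F\<close> are discarded one at a time.\<close>
    have "psd_on {q} K"
      using F psd
    proof (induction F rule: finite_induct)
      case (insert x F)
      then show ?case
        by (metis psd_on_insertD finite_insert insert_commute insert_iff)
    qed simp
    from psd_onD[OF this, of "\<lambda>_. 1"] show ?thesis by (simp add: r_def)
  qed
  \<comment> \<open>The choice \<open>s = - t * S\<close> nearly minimizes the quadratic. Since
    \<open>t * (r + 1) = 1\<close>, its last term is at most \<open>t\<close> times the squared
    modulus of \<open>S\<close>.\<close>
  define t where "t = inverse (r + 1)"
  have t: "t * (r + 1) = 1" "0 < t" using \<open>0 \<le> r\<close> by (simp_all add: t_def)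
  have "cnj (- of_real t * S) * S = - of_real t * (S * cnj S)"
    by simp
  also have "\<dots> = of_real (- t * (cmod S)\<^sup>2)"
    by (simp only: complex_norm_square[symmetric] of_real_mult of_real_minus)
  finally have "Re (cnj (- of_real t * S) * S) = - t * (cmod S)\<^sup>2"
    by (simp only: Re_complex_of_real)
  moreover have "(cmod (- of_real t * S))\<^sup>2 = t * t * (cmod S)\<^sup>2"
    by (simp add: norm_mult power_mult_distrib power2_eq_square)
  ultimately have "0 \<le> R + 2 * (- t * (cmod S)\<^sup>2) + t * t * (cmod S)\<^sup>2 * r"
    using ge[of "- of_real t * S"] by (simp only:)
  also have "t * t * (cmod S)\<^sup>2 * r = t * (cmod S)\<^sup>2 * (t * (r + 1)) - t * t * (cmod S)\<^sup>2"
    by (simp add: algebra_simps)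
  also have "\<dots> \<le> t * (cmod S)\<^sup>2"
    by (simp add: t(1))
  finally have "t * (cmod S)\<^sup>2 \<le> R" by simp
  then have "(r + 1) * (t * (cmod S)\<^sup>2) \<le> (r + 1) * R"
    using \<open>0 \<le> r\<close> by (intro mult_left_mono) auto
  also have "(r + 1) * (t * (cmod S)\<^sup>2) = (t * (r + 1)) * (cmod S)\<^sup>2"
    by (simp only: mult_ac)
  also have "\<dots> = (cmod S)\<^sup>2"
    by (simp only: t(1) mult_1_left)
  finally show ?thesis
    unfolding S_def R_def r_def .
qed

section \<open>A mean ergodic theorem for shift-invariant seminorms on polynomials\<close>

text \<open>The variable X stands for the shift, so a polynomial encodes a finite combination of the
  orbit of one vector, and this one the N-th ergodic average. For \<open>N = 0\<close> it is
  zero.\<close>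

definition avg_poly :: "nat \<Rightarrow> real poly" where
  "avg_poly N = smult (1 / real N) (\<Sum>n<N. monom 1 n)"

lemma avg_poly_mult_X_minus_1:
  "avg_poly N * [:-1, 1:] = smult (1 / real N) (monom 1 N - 1)"
proof -
  have "(\<Sum>n<N. monom (1::real) n) * [:-1, 1:] = monom 1 N - 1"
    using power_diff_1_eq[of "[:0, 1 :: real:]" N]
    by (simp add: monom_altdef mult.commute one_pCons)
  then show ?thesis by (simp only: avg_poly_def mult_smult_left)
qed

text \<open>An average takes the value 1 at X = 1. Divisibility makes its difference from 1 a
  coboundary, on which further averaging telescopes.\<close>

lemma avg_poly_minus_1_dvd:
  assumes "0 < N"
  shows "[:-1, 1:] dvd avg_poly N - 1"
proof -
  have "poly (avg_poly N - 1) 1 = 0"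
    using assms by (simp add: avg_poly_def poly_sum poly_monom)
  then show ?thesis unfolding poly_eq_0_iff_dvd .
qed

text \<open>The model is the norm of p(V)u for an isometry V of a Hilbert space and a vector u. The
  parallelogram law retains what the proof uses of the inner product.\<close>

locale shift_seminorm =
  fixes s :: "real poly \<Rightarrow> real"
  assumes nonneg: "0 \<le> s p"
    and triangle: "s (p + q) \<le> s p + s q"
    and homogeneous: "s (smult c p) = \<bar>c\<bar> * s p"
    and parallelogram: "(s (p - q))\<^sup>2 + (s (p + q))\<^sup>2 = 2 * (s p)\<^sup>2 + 2 * (s q)\<^sup>2"
    and shift: "s (pCons 0 p) = s p"
begin

lemma zero: "s 0 = 0"
  using homogeneous[of 0 0] by simp

lemma minus: "s (- p) = s p"
  using homogeneous[of "-1" p] by simp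

lemma triangle_diff: "s (p - q) \<le> s p + s q"
  using triangle[of p "- q"] by (simp add: minus)

lemma monom_mult: "s (monom 1 n * p) = s p"
  by (induction n) (simp_all add: monom_0 monom_Suc shift flip: one_pCons)

lemma sum_le: "s (\<Sum>i\<in>I. f i) \<le> (\<Sum>i\<in>I. s (f i))"
proof (induction I rule: infinite_finite_induct)
  case (insert x F)
  then show ?case using triangle[of "f x" "sum f F"] by simp
qed (simp_all add: zero)

lemma avg_mult_le: "s (avg_poly N * p) \<le> s p"
proof (cases "N = 0")
  case False
  have "s ((\<Sum>n<N. monom 1 n) * p) \<le> (\<Sum>n<N. s (monom 1 n * p))"
    unfolding sum_distrib_right by (rule sum_le)
  also have "\<dots> = real N * s p" by (simp add: monom_mult)
  finally show ?thesis
    using False by (simp add: avg_poly_def homogeneous field_simps)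
qed (simp add: avg_poly_def zero nonneg)

text \<open>With \<open>avg_poly M - 1\<close> equal to X - 1 times \<open>R\<close>, the product
  telescopes to the difference of a shift of \<open>R\<close> and \<open>R\<close>, divided by
  \<open>N\<close>. Its seminorm is at most \<open>2 * s R / N\<close>.\<close>

lemma avg_mult_avg_close:
  assumes "0 < M"
  shows "(\<lambda>N. s (avg_poly N * (avg_poly M - 1))) \<longlonglongrightarrow> 0"
proof -
  obtain R where R: "avg_poly M - 1 = [:-1, 1:] * R"
    using avg_poly_minus_1_dvd[OF assms] by (auto elim: dvdE)
  have le: "s (avg_poly N * (avg_poly M - 1)) \<le> (2 * s R) * inverse (real N)" for N
  proof -
    have "avg_poly N * (avg_poly M - 1) = smult (1 / real N) (monom 1 N * R - R)"
      unfolding R mult.assoc[symmetric] avg_poly_mult_X_minus_1 by (simp add: algebra_simps)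
    then have "s (avg_poly N * (avg_poly M - 1)) = (1 / real N) * s (monom 1 N * R - R)"
      by (simp add: homogeneous)
    also have "\<dots> \<le> (1 / real N) * (2 * s R)"
      using triangle_diff[of "monom 1 N * R" R] by (intro mult_left_mono) (auto simp: monom_mult)
    finally show ?thesis by (simp add: field_simps)
  qed
  have "(\<lambda>N. (2 * s R) * inverse (real N)) \<longlonglongrightarrow> (2 * s R) * 0"
    by (rule tendsto_mult[OF tendsto_const lim_inverse_n])
  then have "(\<lambda>N. (2 * s R) * inverse (real N)) \<longlonglongrightarrow> 0"
    by (simp only: mult_zero_right)
  then show ?thesis
    by (rule Lim_null_comparison[rotated]) (simp add: nonneg le)
qed

lemma avg_Cauchy:
  assumes "0 < \<epsilon>"
  shows "\<exists>N0. \<forall>N\<ge>N0. \<forall>M\<ge>N0. s (avg_poly N - avg_poly M) < \<epsilon>"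
proof -
  define a where "a N = s (avg_poly N)" for N
  \<comment> \<open>Index 0 is left out because \<open>avg_poly 0\<close> is zero and would make the
    infimum trivial.\<close>
  define I where "I = Inf (a ` {0<..})"
  have bdd: "bdd_below (a ` {0<..})"
    by (rule bdd_belowI2[of _ 0]) (simp add: a_def nonneg)
  have I_le: "I \<le> a N" if "0 < N" for N
    unfolding I_def using bdd that by (intro cINF_lower) auto
  have "0 \<le> I"
    unfolding I_def by (rule cINF_greatest) (auto simp: a_def nonneg)
  \<comment> \<open>Take \<open>M\<close> with \<open>a M\<close> near the infimum. For large
    \<open>N\<close> the average \<open>avg_poly N\<close> is close to
    \<open>avg_poly N * avg_poly M\<close>, whose seminorm is at most \<open>a M\<close> by
    contractivity.\<close>
  have near: "\<exists>N0. \<forall>N\<ge>N0. a N < I + \<eta>" if \<eta>: "0 < \<eta>" for \<eta>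
  proof -
    obtain M where M: "0 < M" "a M < I + \<eta> / 2"
      using cInf_lessD[of "a ` {0<..}" "I + \<eta> / 2"] \<eta> by (auto simp: I_def)
    have "\<forall>\<^sub>F N in sequentially. s (avg_poly N * (avg_poly M - 1)) < \<eta> / 2"
      using avg_mult_avg_close[OF M(1)] \<eta> by (intro order_tendstoD(2)) auto
    then obtain N0 where N0: "\<And>N. N \<ge> N0 \<Longrightarrow> s (avg_poly N * (avg_poly M - 1)) < \<eta> / 2"
      by (auto simp: eventually_sequentially)
    have "a N < I + \<eta>" if "N \<ge> N0" for N
    proof -
      have "a N = s (avg_poly N * avg_poly M - avg_poly N * (avg_poly M - 1))"
        by (simp add: a_def algebra_simps)
      also have "\<dots> \<le> s (avg_poly N * avg_poly M) + s (avg_poly N * (avg_poly M - 1))"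
        by (rule triangle_diff)
      also have "\<dots> < a M + \<eta> / 2"
        using avg_mult_le[of N "avg_poly M"] N0[OF that] by (simp add: a_def)
      finally show ?thesis using M(2) by linarith
    qed
    then show ?thesis by blast
  qed
  \<comment> \<open>Multiplication by \<open>avg_poly L\<close> is a contraction and, for large
    \<open>L\<close>, brings the sum of the two averages close to twice \<open>avg_poly L\<close>,
    whose seminorm is at least \<open>2 * I\<close>.\<close>
  have sum_ge: "2 * I \<le> s (avg_poly N + avg_poly M)" if NM: "0 < N" "0 < M" for N M
  proof (rule LIMSEQ_le_const2)
    let ?e = "\<lambda>L. s (avg_poly L * (avg_poly N - 1)) + s (avg_poly L * (avg_poly M - 1))"
    show "(\<lambda>L. 2 * I - ?e L) \<longlonglongrightarrow> 2 * I"
      using tendsto_diff[OF tendsto_const tendsto_add[OF avg_mult_avg_close[OF NM(1)]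
            avg_mult_avg_close[OF NM(2)]], of "2 * I"] by simp
    have "2 * I - ?e L \<le> s (avg_poly N + avg_poly M)" if "0 < L" for L
    proof -
      let ?d = "avg_poly L * (avg_poly N - 1) + avg_poly L * (avg_poly M - 1)"
      have "2 * a L = s (smult 2 (avg_poly L))" by (simp add: homogeneous a_def)
      also have "smult 2 (avg_poly L) = avg_poly L + avg_poly L"
        using smult_add_left[of 1 1 "avg_poly L"] by simp
      also have "\<dots> = avg_poly L * (avg_poly N + avg_poly M) - ?d"
        by (simp add: algebra_simps)
      also have "s \<dots> \<le> s (avg_poly L * (avg_poly N + avg_poly M)) + s ?d"
        by (rule triangle_diff)
      also have "\<dots> \<le> s (avg_poly N + avg_poly M) + ?e L"
        by (intro add_mono avg_mult_le triangle)
      finally show ?thesis using I_le[OF that] by linarith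
    qed
    then show "\<exists>L0. \<forall>L\<ge>L0. 2 * I - ?e L \<le> s (avg_poly N + avg_poly M)"
      by (intro exI[of _ 1]) auto
  qed
  \<comment> \<open>Chosen so that \<open>4 * \<eta> * (2 * I + \<eta>)\<close>, which is the excess
    left over in the parallelogram law, is at most the square of \<epsilon>. The bound 1 on \<eta>
    controls the second factor.\<close>
  define \<eta> where "\<eta> = min 1 (\<epsilon>\<^sup>2 / (4 * (2 * I + 1)))"
  have "0 < \<eta>" using assms \<open>0 \<le> I\<close> by (simp add: \<eta>_def)
  have "(2 * I + \<eta>) * (4 * \<eta>) \<le> (2 * I + 1) * (4 * (\<epsilon>\<^sup>2 / (4 * (2 * I + 1))))"
    using \<open>0 \<le> I\<close> \<open>0 < \<eta>\<close> by (intro mult_mono) (auto simp: \<eta>_def)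
  also have "\<dots> = \<epsilon>\<^sup>2" using \<open>0 \<le> I\<close> by (simp add: field_simps)
  finally have \<eta>: "4 * (I + \<eta>)\<^sup>2 - 4 * I\<^sup>2 \<le> \<epsilon>\<^sup>2"
    by (simp add: power2_eq_square algebra_simps)
  obtain N0 where N0: "\<And>N. N \<ge> N0 \<Longrightarrow> a N < I + \<eta>"
    using near[OF \<open>0 < \<eta>\<close>] by blast
  \<comment> \<open>\<open>Suc N0\<close> makes both indices positive, as \<open>sum_ge\<close>
    requires.\<close>
  have "s (avg_poly N - avg_poly M) < \<epsilon>" if "N \<ge> Suc N0" "M \<ge> Suc N0" for N M
  proof -
    have sq: "(a L)\<^sup>2 < (I + \<eta>)\<^sup>2" if "L \<ge> Suc N0" for L
      using N0[of L] that by (intro power_strict_mono) (auto simp: a_def nonneg)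
    have "(2 * I)\<^sup>2 \<le> (s (avg_poly N + avg_poly M))\<^sup>2"
      using \<open>0 \<le> I\<close> that by (intro power_mono sum_ge) auto
    then have "4 * I\<^sup>2 \<le> (s (avg_poly N + avg_poly M))\<^sup>2"
      by (simp add: power_mult_distrib)
    then have "(s (avg_poly N - avg_poly M))\<^sup>2 < \<epsilon>\<^sup>2"
      using parallelogram[of "avg_poly N" "avg_poly M"] sq[OF that(1)] sq[OF that(2)] \<eta>
      unfolding a_def by argo
    then show ?thesis
      by (rule power2_less_imp_less) (rule less_imp_le[OF assms])
  qed
  then show ?thesis by blast
qed

end

section \<open>Cesaro means of coefficient sequences\<close>

definition poly_lin :: "(nat \<Rightarrow> 'b::real_vector) \<Rightarrow> real poly \<Rightarrow> 'b" where
  "poly_lin f p = (\<Sum>i\<le>degree p. coeff p i *\<^sub>R f i)"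

lemma poly_lin_eq:
  assumes "degree p \<le> n"
  shows "poly_lin f p = (\<Sum>i\<le>n. coeff p i *\<^sub>R f i)"
  unfolding poly_lin_def using assms
  by (intro sum.mono_neutral_left) (auto simp: coeff_eq_0)

lemma poly_lin_add: "poly_lin f (p + q) = poly_lin f p + poly_lin f q"
proof -
  let ?n = "max (degree p) (degree q)"
  have "degree (p + q) \<le> ?n" by (rule degree_add_le_max)
  then show ?thesis
    using poly_lin_eq[of p ?n f] poly_lin_eq[of q ?n f] poly_lin_eq[of "p + q" ?n f]
    by (simp add: scaleR_add_left sum.distrib)
qed

lemma poly_lin_smult: "poly_lin f (smult c p) = c *\<^sub>R poly_lin f p"
  using poly_lin_eq[OF degree_smult_le, of f c p] by (simp add: poly_lin_def scaleR_sum_right)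

lemma poly_lin_diff: "poly_lin f (p - q) = poly_lin f p - poly_lin f q"
proof -
  have "p - q = p + smult (-1) q" by simp
  then show ?thesis by (simp only: poly_lin_add poly_lin_smult) simp
qed

lemma poly_lin_pCons_0: "poly_lin f (pCons 0 p) = poly_lin (\<lambda>i. f (Suc i)) p"
proof -
  have "poly_lin f (pCons 0 p) = (\<Sum>i\<le>Suc (degree p). coeff (pCons 0 p) i *\<^sub>R f i)"
    by (rule poly_lin_eq) (rule degree_pCons_le)
  then show ?thesis
    by (simp add: sum.atMost_Suc_shift poly_lin_def del: sum.atMost_Suc)
qed

lemma poly_lin_monom: "poly_lin f (monom c n) = c *\<^sub>R f n"
proof -
  have "poly_lin f (monom c n) = (\<Sum>i\<le>n. coeff (monom c n) i *\<^sub>R f i)"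
    by (rule poly_lin_eq) (rule degree_monom_le)
  also have "\<dots> = (\<Sum>i\<le>n. if i = n then c *\<^sub>R f n else 0)"
    by (intro sum.cong) auto
  finally show ?thesis by simp
qed

lemma poly_lin_avg_poly: "poly_lin f (avg_poly N) = (1 / real N) *\<^sub>R (\<Sum>n<N. f n)"
proof -
  have "poly_lin f (\<Sum>n<N. monom 1 n) = (\<Sum>n<N. f n)"
    by (induction N) (simp_all add: poly_lin_add poly_lin_monom, simp add: poly_lin_def)
  then show ?thesis by (simp add: avg_poly_def poly_lin_smult)
qed

section \<open>Possibly degenerate shift-invariant inner products on polynomials\<close>

locale shift_form =
  fixes B :: "real poly \<Rightarrow> real poly \<Rightarrow> real"
  assumes add_left: "B (p + q) r = B p r + B q r"
    and smult_left: "B (smult c p) r = c * B p r"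
    and sym: "B p q = B q p"
    and psd: "0 \<le> B p p"
    and shift: "B (pCons 0 p) (pCons 0 p) = B p p"
begin

lemma add_right: "B r (p + q) = B r p + B r q"
  by (simp add: sym[of r] add_left)

lemma smult_right: "B r (smult c p) = c * B r p"
  by (simp add: sym[of r] smult_left)

lemma expand: "B (p + smult c q) (p + smult c q) = B p p + 2 * c * B p q + c\<^sup>2 * B q q"
  by (simp add: add_left add_right smult_left smult_right sym[of q p] power2_eq_square algebra_simps)

lemma Cauchy_Schwarz: "(B p q)\<^sup>2 \<le> B p p * B q q"
proof (cases "B q q = 0")
  case True
  have "B p q = 0"
  proof (rule ccontr)
    assume nz: "B p q \<noteq> 0"
    \<comment> \<open>With \<open>B q q = 0\<close> the expansion is affine in \<open>c\<close>, and
      this \<open>c\<close> makes it equal to -1.\<close>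
    define c where "c = - (B p p + 1) / (2 * B p q)"
    have "2 * c * B p q = - (B p p + 1)" using nz by (simp add: c_def)
    then show False using psd[of "p + smult c q"] True by (simp add: expand)
  qed
  then show ?thesis by (simp add: psd)
next
  case False
  then have pos: "0 < B q q" using psd[of q] by simp
  define c where "c = - B p q / B q q"
  have c: "c * B q q = - B p q" using pos by (simp add: c_def)
  have "0 \<le> B p p + 2 * c * B p q + c * (c * B q q)"
    using psd[of "p + smult c q"] by (simp add: expand power2_eq_square mult.assoc)
  then have "0 \<le> B p p + c * B p q" unfolding c by simp
  then have "0 \<le> (B p p + c * B p q) * B q q" using pos by simp
  also have "\<dots> = B p p * B q q + (c * B q q) * B p q" by (simp add: algebra_simps)
  finally show ?thesis unfolding c by (simp add: power2_eq_square)
qed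

sublocale shift_seminorm "\<lambda>p. sqrt (B p p)"
proof
  fix p q :: "real poly" and c :: real
  show "0 \<le> sqrt (B p p)" by (simp add: psd)
  have "B p q \<le> sqrt (B p p) * sqrt (B q q)"
    using real_le_rsqrt[OF Cauchy_Schwarz[of p q]] by (simp add: real_sqrt_mult)
  then have "B (p + q) (p + q) \<le> (sqrt (B p p) + sqrt (B q q))\<^sup>2"
    using expand[of p 1 q] by (simp add: power2_sum psd)
  then show "sqrt (B (p + q) (p + q)) \<le> sqrt (B p p) + sqrt (B q q)"
    by (rule real_le_lsqrt[rotated -1]) (simp_all add: psd)
  have "B (smult c p) (smult c p) = c\<^sup>2 * B p p"
    by (simp add: smult_left smult_right power2_eq_square)
  then show "sqrt (B (smult c p) (smult c p)) = \<bar>c\<bar> * sqrt (B p p)"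
    by (simp add: real_sqrt_mult)
  show "(sqrt (B (p - q) (p - q)))\<^sup>2 + (sqrt (B (p + q) (p + q)))\<^sup>2
      = 2 * (sqrt (B p p))\<^sup>2 + 2 * (sqrt (B q q))\<^sup>2"
    unfolding real_sqrt_pow2[OF psd] using expand[of p 1 q] expand[of p "-1" q] by simp
  show "sqrt (B (pCons 0 p) (pCons 0 p)) = sqrt (B p p)" by (simp add: shift)
qed

end

text \<open>
  The index \<open>None\<close> stands for the fixed vector \<open>v\<close> and \<open>Some n\<close> for \<open>U^n u\<close> in a coefficient
  \<open>\<langle>U^n u, v\<rangle>\<close>. The kernel plays the role of a Gram matrix in a tensor power of the Hilbert space,
  which thereby need not be constructed.
\<close>

definition coefficient_sequence :: "(nat \<Rightarrow> complex) \<Rightarrow> bool" where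
  "coefficient_sequence a \<longleftrightarrow> (\<exists>K :: nat option \<Rightarrow> nat option \<Rightarrow> complex.
     (\<forall>F. finite F \<longrightarrow> psd_on F K) \<and> (\<forall>i j. K i j = cnj (K j i)) \<and>
     (\<forall>i j. K (Some (Suc i)) (Some (Suc j)) = K (Some i) (Some j)) \<and> (\<forall>n. a n = K (Some n) None))"

lemma coefficient_sequenceE:
  assumes "coefficient_sequence a"
  obtains K :: "nat option \<Rightarrow> nat option \<Rightarrow> complex"
  where "\<And>F. finite F \<Longrightarrow> psd_on F K" "\<And>i j. K i j = cnj (K j i)"
    "\<And>i j. K (Some (Suc i)) (Some (Suc j)) = K (Some i) (Some j)" "\<And>n. a n = K (Some n) None"
  using assms unfolding coefficient_sequence_def by blast

text \<open>The form of the all-ones kernel is the squared modulus of the sum of the coefficients.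
  This is the empty product, from which the other sequences are built.\<close>

lemma coefficient_sequence_one: "coefficient_sequence (\<lambda>_. 1)"
proof -
  have "psd_on F (\<lambda>_ _. 1)" for F :: "nat option set"
  proof -
    have "(\<Sum>i\<in>F. \<Sum>j\<in>F. c i * cnj (c j)) = (\<Sum>i\<in>F. c i) * cnj (\<Sum>i\<in>F. c i)" for c
      by (simp add: sum_product)
    then show ?thesis
      by (simp only: psd_on_def mult_1_right complex_norm_square[symmetric] Re_complex_of_real) simp
  qed
  then show ?thesis
    unfolding coefficient_sequence_def by (intro exI[of _ "\<lambda>_ _. 1"]) simp
qed

text \<open>The kernel of \<open>a\<close> is multiplied entrywise by the Gram matrix of
  \<open>v\<close> and the orbit of \<open>u\<close>. The product is positive semidefinite by the
  Schur product theorem and shift-invariant because \<open>U\<close> preserves inner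
  products.\<close>

lemma coefficient_sequence_mult:
  fixes U :: "'a::complex_inner \<Rightarrow> 'a"
  assumes a: "coefficient_sequence a" and U: "\<And>x y. cinner (U x) (U y) = cinner x y"
  shows "coefficient_sequence (\<lambda>n. a n * cinner ((U ^^ n) u) v)"
proof -
  obtain K where K: "\<And>F. finite F \<Longrightarrow> psd_on F K" "\<And>i j. K i j = cnj (K j i)"
    "\<And>i j. K (Some (Suc i)) (Some (Suc j)) = K (Some i) (Some j)" "\<And>n. a n = K (Some n) None"
    using coefficient_sequenceE[OF a] by blast
  define w where "w = case_option v (\<lambda>n. (U ^^ n) u)"
  define L where "L i j = K i j * cinner (w i) (w j)" for i j
  have "psd_on F L" if "finite F" for F
    unfolding L_def using psd_on_mult_Gram[OF that K(1)[OF that]] .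
  moreover have "L i j = cnj (L j i)" for i j
    unfolding L_def complex_cnj_mult K(2)[of i j] cinner_commute[of "w i" "w j"] ..
  moreover have "L (Some (Suc i)) (Some (Suc j)) = L (Some i) (Some j)" for i j
    by (simp add: L_def K(3) w_def U)
  moreover have "a n * cinner ((U ^^ n) u) v = L (Some n) None" for n
    by (simp add: L_def K(4) w_def)
  ultimately show ?thesis
    unfolding coefficient_sequence_def by blast
qed

text \<open>Cauchy-Schwarz applies to the indices \<open>Some n\<close> and \<open>None\<close>, and
  the diagonal of the kernel is constant along the shift.\<close>

lemma coefficient_sequence_bounded:
  assumes "coefficient_sequence a"
  shows "\<exists>C. \<forall>n. cmod (a n) \<le> C"
proof -
  obtain K where K: "\<And>F. finite F \<Longrightarrow> psd_on F K" "\<And>i j. K i j = cnj (K j i)"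
    "\<And>i j. K (Some (Suc i)) (Some (Suc j)) = K (Some i) (Some j)" "\<And>n. a n = K (Some n) None"
    using coefficient_sequenceE[OF assms] by blast
  have diag: "K (Some n) (Some n) = K (Some 0) (Some 0)" for n
    by (induction n) (simp_all add: K(3))
  have "cmod (a n) \<le> sqrt ((Re (K None None) + 1) * Re (K (Some 0) (Some 0)))" for n
    using psd_on_Cauchy_Schwarz[of "{Some n}" None K "\<lambda>_. 1", OF _ _ K(1) K(2)]
    by (intro real_le_rsqrt) (simp add: K(4) diag[of n])
  then show ?thesis by blast
qed

text \<open>The kernel on the indices \<open>Some n\<close> yields a shift-invariant form
  \<open>B\<close>. By Cauchy-Schwarz against the index \<open>None\<close>, the functional
  \<open>poly_lin a\<close> is bounded for its seminorm, so it maps the Cauchy sequence of averages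
  to a Cauchy sequence of Cesaro means.\<close>

theorem coefficient_sequence_Cesaro:
  assumes "coefficient_sequence a"
  shows "convergent (\<lambda>N. (1 / of_nat N) * (\<Sum>n<N. a n))"
proof -
  obtain K where K: "\<And>F. finite F \<Longrightarrow> psd_on F K" "\<And>i j. K i j = cnj (K j i)"
    "\<And>i j. K (Some (Suc i)) (Some (Suc j)) = K (Some i) (Some j)" "\<And>n. a n = K (Some n) None"
    using coefficient_sequenceE[OF assms] by blast
  \<comment> \<open>The polynomials have real coefficients, so the quadratic form depends only on
    the real parts of the kernel.\<close>
  define G where "G i j = Re (K (Some i) (Some j))" for i j
  define B where "B p q = poly_lin (\<lambda>i. poly_lin (G i) q) p" for p q
  have B_eq: "B p q = (\<Sum>i\<le>degree p. \<Sum>j\<le>degree q. coeff p i * coeff q j * G i j)" for p q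
    by (simp add: B_def poly_lin_def sum_distrib_left mult.assoc)
  define co where "co p i = complex_of_real (coeff p (the i))" for p i
  have BK: "B p p = Re (\<Sum>i\<in>Some ` {..degree p}. \<Sum>j\<in>Some ` {..degree p}.
      co p i * cnj (co p j) * K i j)" for p
    by (simp add: B_eq G_def sum.reindex co_def mult.assoc)
  have G_sym: "G i j = G j i" for i j
    using K(2)[of "Some i" "Some j"] by (simp add: G_def)
  have G_shift: "G (Suc i) (Suc j) = G i j" for i j
    by (simp add: G_def K(3))
  interpret shift_form B
  proof
    show "B p q = B q p" for p q
      unfolding B_eq by (subst sum.swap) (simp add: G_sym mult_ac)
    show "0 \<le> B p p" for p
      unfolding BK by (rule psd_onD) (simp add: K(1))
    show "B (pCons 0 p) (pCons 0 p) = B p p" for p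
      by (simp add: B_def poly_lin_pCons_0 G_shift)
  qed (simp_all add: B_def poly_lin_add poly_lin_smult)
  define C where "C = sqrt (Re (K None None) + 1)"
  have bound: "cmod (poly_lin a p) \<le> C * sqrt (B p p)" for p
  proof -
    have "poly_lin a p = (\<Sum>i\<in>Some ` {..degree p}. co p i * K i None)"
      by (simp add: poly_lin_def sum.reindex co_def K(4) scaleR_conv_of_real)
    moreover have "(cmod (\<Sum>i\<in>Some ` {..degree p}. co p i * K i None))\<^sup>2
        \<le> (Re (K None None) + 1) * B p p"
      unfolding BK by (rule psd_on_Cauchy_Schwarz) (auto intro: K)
    ultimately show ?thesis
      unfolding C_def real_sqrt_mult[symmetric] by (intro real_le_rsqrt) simp
  qed
  have "Cauchy (\<lambda>N. poly_lin a (avg_poly N))"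
  proof (rule metric_CauchyI)
    fix e :: real assume "0 < e"
    have "0 \<le> Re (K None None)"
      using psd_onD[OF K(1), of "{None}" "\<lambda>_. 1"] by simp
    then have "0 < C" by (simp add: C_def)
    with \<open>0 < e\<close> have "0 < e / C" by simp
    from avg_Cauchy[OF this] obtain N0 where N0: "\<And>N M. N \<ge> N0 \<Longrightarrow> M \<ge> N0 \<Longrightarrow>
        sqrt (B (avg_poly N - avg_poly M) (avg_poly N - avg_poly M)) < e / C" by blast
    have "dist (poly_lin a (avg_poly N)) (poly_lin a (avg_poly M)) < e"
      if "N \<ge> N0" "M \<ge> N0" for N M
    proof -
      have "dist (poly_lin a (avg_poly N)) (poly_lin a (avg_poly M))
          \<le> C * sqrt (B (avg_poly N - avg_poly M) (avg_poly N - avg_poly M))"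
        using bound[of "avg_poly N - avg_poly M"] by (simp add: dist_norm poly_lin_diff)
      also have "\<dots> < C * (e / C)"
        using N0[OF that] \<open>0 < C\<close> by (rule mult_strict_left_mono)
      also have "\<dots> = e" using \<open>0 < C\<close> by simp
      finally show ?thesis .
    qed
    then show "\<exists>N0. \<forall>N\<ge>N0. \<forall>M\<ge>N0.
        dist (poly_lin a (avg_poly N)) (poly_lin a (avg_poly M)) < e" by blast
  qed
  then have "convergent (\<lambda>N. poly_lin a (avg_poly N))" by (rule Cauchy_convergent)
  then show ?thesis
    by (simp add: poly_lin_avg_poly scaleR_conv_of_real)
qed

section \<open>Entangled averages\<close>

definition multi_avg :: "nat \<Rightarrow> nat \<Rightarrow> ((nat \<Rightarrow> nat) \<Rightarrow> complex) \<Rightarrow> complex" where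
  "multi_avg k N f = (1 / of_nat N ^ k) * (\<Sum>n \<in> {1..k} \<rightarrow>\<^sub>E {0..<N}. f n)"

lemma norm_multi_avg_le:
  assumes "\<And>n. cmod (f n) \<le> C"
  shows "cmod (multi_avg k N f) \<le> C"
proof -
  have "0 \<le> C" using assms[of undefined] norm_ge_zero[of "f undefined"] by linarith
  have "cmod (\<Sum>n \<in> {1..k} \<rightarrow>\<^sub>E {0..<N}. f n) \<le> (\<Sum>n \<in> {1..k} \<rightarrow>\<^sub>E {0..<N}. C)"
    using assms by (intro sum_norm_le)
  also have "\<dots> = real N ^ k * C"
    by (simp add: card_PiE)
  finally have "cmod (multi_avg k N f) \<le> (1 / real N ^ k) * (real N ^ k * C)"
    unfolding multi_avg_def norm_mult
    by (intro mult_mono) (simp_all add: norm_divide norm_power)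
  \<comment> \<open>Only an inequality: for \<open>N = 0\<close> and positive \<open>k\<close> the
    left-hand side is 0.\<close>
  also have "\<dots> \<le> C" using \<open>0 \<le> C\<close> by simp
  finally show ?thesis .
qed

lemma multi_avg_sum: "multi_avg k N (\<lambda>n. \<Sum>e\<in>E. f e n) = (\<Sum>e\<in>E. multi_avg k N (f e))"
  unfolding multi_avg_def by (subst sum.swap) (simp add: sum_distrib_left)

lemma multi_avg_diff: "multi_avg k N (\<lambda>n. f n - g n) = multi_avg k N f - multi_avg k N g"
  by (simp add: multi_avg_def sum_subtractf right_diff_distrib)

lemma multi_avg_prod:
  "multi_avg k N (\<lambda>n. \<Prod>i\<in>{1..k}. a i (n i)) = (\<Prod>i\<in>{1..k}. (1 / of_nat N) * (\<Sum>n<N. a i n))"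
proof -
  have "(\<Prod>i\<in>{1..k}. \<Sum>n\<in>{0..<N}. a i n) = (\<Sum>n \<in> {1..k} \<rightarrow>\<^sub>E {0..<N}. \<Prod>i\<in>{1..k}. a i (n i))"
    by (rule prod_sum_PiE) simp_all
  then show ?thesis
    by (simp add: multi_avg_def prod_dividef atLeast0LessThan)
qed

text \<open>Serves to absorb a factor that depends on the single coordinate \<open>n i0\<close> into
  the sequence with index \<open>i0\<close>.\<close>

lemma prod_fun_upd_mult:
  fixes a :: "'i \<Rightarrow> 'n \<Rightarrow> 'b::comm_monoid_mult"
  assumes "finite I" "i0 \<in> I"
  shows "(\<Prod>i\<in>I. (a(i0 := \<lambda>n. a i0 n * b n)) i (n i)) = (\<Prod>i\<in>I. a i (n i)) * b (n i0)"
proof -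
  have "(\<Prod>i\<in>I - {i0}. (a(i0 := \<lambda>n. a i0 n * b n)) i (n i)) = (\<Prod>i\<in>I - {i0}. a i (n i))"
    by (intro prod.cong) auto
  then show ?thesis
    unfolding prod.remove[OF assms] by (simp add: mult_ac)
qed

lemma convergent_uniform_approximation:
  fixes f :: "nat \<Rightarrow> complex"
  assumes "\<And>\<epsilon>. 0 < \<epsilon> \<Longrightarrow> \<exists>g. convergent g \<and> (\<forall>N. cmod (f N - g N) \<le> \<epsilon>)"
  shows "convergent f"
proof -
  have "Cauchy f"
  proof (rule metric_CauchyI)
    fix e :: real assume "0 < e"
    then obtain g where g: "convergent g" "\<And>N. cmod (f N - g N) \<le> e / 4"
      using assms[of "e / 4"] by auto
    from g(1) have "Cauchy g" by (rule convergent_Cauchy)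
    then obtain N0 where N0: "\<And>N M. N \<ge> N0 \<Longrightarrow> M \<ge> N0 \<Longrightarrow> dist (g N) (g M) < e / 4"
      using \<open>0 < e\<close> by (metis metric_CauchyD divide_pos_pos zero_less_numeral)
    have "dist (f N) (f M) < e" if "N \<ge> N0" "M \<ge> N0" for N M
    proof -
      have "dist (f N) (f M) \<le> dist (f N) (g N) + dist (g N) (g M) + dist (f M) (g M)"
        by (metis add.commute add_left_mono dist_commute dist_triangle dist_triangle_le add.assoc)
      then show ?thesis
        using N0[OF that] g(2)[of N] g(2)[of M] \<open>0 < e\<close> unfolding dist_norm by linarith
    qed
    then show "\<exists>N0. \<forall>N\<ge>N0. \<forall>M\<ge>N0. dist (f N) (f M) < e" by blast
  qed
  then show ?thesis by (rule Cauchy_convergent)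
qed

section \<open>Linearity and uniform boundedness of the words\<close>

lemma norm_funpow_isometry:
  fixes U :: "'a::real_normed_vector \<Rightarrow> 'a"
  assumes "\<And>x. norm (U x) = norm x"
  shows "norm ((U ^^ n) x) = norm x"
  by (induction n) (simp_all add: assms)

lemma bounded_clinear_comp:
  "bounded_clinear S \<Longrightarrow> bounded_clinear T \<Longrightarrow> bounded_clinear (S \<circ> T)"
  by (simp add: bounded_clinear_def bounded_linear_compose comp_def)

lemma bounded_clinear_funpow:
  assumes "bounded_clinear U"
  shows "bounded_clinear (U ^^ n)"
proof (induction n)
  case 0
  show ?case by (simp add: bounded_clinear_def bounded_linear_ident id_def)
next
  case (Suc n)
  then show ?case using bounded_clinear_comp[OF assms] by (simp only: funpow.simps)
qed

lemma bounded_clinear_add: "bounded_clinear T \<Longrightarrow> T (x + y) = T x + T y"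
  by (simp add: bounded_clinear_def linear_simps(1))

lemma bounded_clinear_diff: "bounded_clinear T \<Longrightarrow> T (x - y) = T x - T y"
  by (simp add: bounded_clinear_def linear_simps(2))

lemma bounded_clinear_scaleC: "bounded_clinear T \<Longrightarrow> T (c *\<^sub>C x) = c *\<^sub>C T x"
  by (simp add: bounded_clinear_def)

lemma bounded_clinear_sum: "bounded_clinear T \<Longrightarrow> T (\<Sum>i\<in>I. f i) = (\<Sum>i\<in>I. T (f i))"
  by (simp add: bounded_clinear_def bounded_linear.linear linear_sum)

lemma bounded_clinear_intro:
  assumes "\<And>x y. T (x + y) = T x + T y" "\<And>c x. T (c *\<^sub>C x) = c *\<^sub>C T x"
    "\<And>x. norm (T x) \<le> norm x * C"
  shows "bounded_clinear T"
  unfolding bounded_clinear_def using assms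
  by (auto simp: scaleR_eq_scaleC intro!: bounded_linear_intro[where K = C])

lemma bounded_clinear_entangled_word:
  assumes "bounded_clinear U" "\<And>i. i \<in> {1..j} \<Longrightarrow> bounded_clinear (A i)"
  shows "bounded_clinear (entangled_word U A \<alpha> n j)"
  using assms(2)
proof (induction j)
  case 0
  show ?case using bounded_clinear_funpow[OF assms(1)] by simp
next
  case (Suc j)
  then show ?case
    by (simp only: entangled_word.simps)
      (intro bounded_clinear_comp bounded_clinear_funpow assms(1), auto)
qed

text \<open>Powers of \<open>U\<close> preserve norms, so only the bounds of the \<open>A i\<close>
  enter and the constant is uniform in \<open>n\<close>.\<close>

lemma entangled_word_bound:
  fixes U :: "'a::complex_inner \<Rightarrow> 'a"
  assumes "\<And>x. norm (U x) = norm x" "\<And>i. i \<in> {1..j} \<Longrightarrow> bounded_clinear (A i)"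
  shows "\<exists>C\<ge>0. \<forall>n x. norm (entangled_word U A \<alpha> n j x) \<le> C * norm x"
  using assms(2)
proof (induction j)
  case 0
  show ?case by (rule exI[of _ 1]) (simp add: norm_funpow_isometry assms(1))
next
  case (Suc j)
  then obtain C where C: "C \<ge> 0" "\<And>n x. norm (entangled_word U A \<alpha> n j x) \<le> C * norm x"
    by auto
  have "bounded_linear (A (Suc j))"
    using Suc.prems[of "Suc j"] by (simp add: bounded_clinear_def)
  then obtain D where D: "D > 0" "\<And>x. norm (A (Suc j) x) \<le> norm x * D"
    using bounded_linear.pos_bounded by blast
  have "norm (entangled_word U A \<alpha> n (Suc j) x) \<le> C * D * norm x" for n x
  proof -
    let ?z = "(U ^^ n (\<alpha> (Suc (Suc j)))) x"
    have "norm (entangled_word U A \<alpha> n (Suc j) x) \<le> C * norm (A (Suc j) ?z)"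
      using C(2) by simp
    also have "\<dots> \<le> C * (norm ?z * D)"
      using C(1) D(2) by (intro mult_left_mono)
    finally show ?thesis
      by (simp add: norm_funpow_isometry assms(1) mult_ac)
  qed
  then show ?case using C(1) D(1) by (intro exI[of _ "C * D"]) simp
qed

text \<open>The sequences \<open>a i\<close> are there for the induction, which replaces the last
  operator by one of finite rank. Each rank-one term cuts the word: the coefficient of the last
  power of \<open>U\<close> is absorbed into one of the \<open>a i\<close>, and a shorter word
  applied to a fixed vector remains. Several absorptions may hit the same \<open>a i\<close>, which
  is how the products arise.\<close>

lemma convergent_entangled_average:
  fixes U :: "'a::chilbert_space \<Rightarrow> 'a"
  assumes U: "bounded_clinear U" "\<And>x y. cinner (U x) (U y) = cinner x y"
    and A: "\<And>i. i \<in> {1..j} \<Longrightarrow> compact_operator (A i)"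
    and \<alpha>: "\<And>i. i \<in> {1..Suc j} \<Longrightarrow> \<alpha> i \<in> {1..k}"
    and a: "\<And>i. i \<in> {1..k} \<Longrightarrow> coefficient_sequence (a i)"
  shows "convergent (\<lambda>N. multi_avg k N
    (\<lambda>n. (\<Prod>i\<in>{1..k}. a i (n i)) * cinner (entangled_word U A \<alpha> n j x) y))"
  using A \<alpha> a
proof (induction j arbitrary: a x)
  case 0
  define i0 where "i0 = \<alpha> 1"
  define b where "b = a(i0 := \<lambda>n. a i0 n * cinner ((U ^^ n) x) y)"
  \<comment> \<open>The word is a single power of \<open>U\<close>. Once its coefficient is
    absorbed, the average factors into Cesaro means.\<close>
  have i0: "i0 \<in> {1..k}" using 0 by (simp add: i0_def)
  have b: "coefficient_sequence (b i)" if "i \<in> {1..k}" for i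
    using 0(3)[OF that] coefficient_sequence_mult[OF _ U(2), of "a i" x y]
    by (cases "i = i0") (simp_all add: b_def)
  have "\<forall>i\<in>{1..k}. \<exists>l. (\<lambda>N. (1 / of_nat N) * (\<Sum>n<N. b i n)) \<longlonglongrightarrow> l"
    using coefficient_sequence_Cesaro[OF b] by (simp add: convergent_def)
  then obtain l where l: "\<And>i. i \<in> {1..k} \<Longrightarrow> (\<lambda>N. (1 / of_nat N) * (\<Sum>n<N. b i n)) \<longlonglongrightarrow> l i"
    by metis
  have "(\<lambda>N. multi_avg k N (\<lambda>n. \<Prod>i\<in>{1..k}. b i (n i))) \<longlonglongrightarrow> (\<Prod>i\<in>{1..k}. l i)"
    unfolding multi_avg_prod using l by (rule tendsto_prod)
  moreover have "(\<Prod>i\<in>{1..k}. b i (n i))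
      = (\<Prod>i\<in>{1..k}. a i (n i)) * cinner (entangled_word U A \<alpha> n 0 x) y" for n
    using prod_fun_upd_mult[OF finite_atLeastAtMost i0, of a "\<lambda>n. cinner ((U ^^ n) x) y" n]
    by (simp only: b_def i0_def entangled_word.simps)
  ultimately show ?case by (auto simp: convergent_def)
next
  case (Suc j)
  have cpt: "compact_operator (A (Suc j))" using Suc.prems(1) by simp
  have bA: "bounded_clinear (A i)" if "i \<in> {1..j}" for i
    using Suc.prems(1)[of i] that by (simp add: compact_operator_def)
  have norm_U: "norm (U z) = norm z" for z
    by (simp add: norm_eq_sqrt_cinner U(2))
  have i0: "\<alpha> (Suc (Suc j)) \<in> {1..k}" using Suc.prems(2) by simp
  define W where "W n = entangled_word U A \<alpha> n j" for n
  define z where "z n = (U ^^ n (\<alpha> (Suc (Suc j)))) x" for n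
  have W: "bounded_clinear (W n)" for n
    unfolding W_def by (rule bounded_clinear_entangled_word[OF U(1) bA])
  obtain C where C: "C \<ge> 0" "\<And>n v. norm (W n v) \<le> C * norm v"
    using entangled_word_bound[where U = U and A = A and j = j and \<alpha> = \<alpha>, OF norm_U bA]
    unfolding W_def by auto
  have "\<forall>i\<in>{1..k}. \<exists>D. \<forall>n. cmod (a i n) \<le> D"
    using coefficient_sequence_bounded[OF Suc.prems(3)] by blast
  then obtain D where D: "\<And>i n. i \<in> {1..k} \<Longrightarrow> cmod (a i n) \<le> D i" by metis
  define P where "P n = (\<Prod>i\<in>{1..k}. a i (n i))" for n
  have P: "cmod (P n) \<le> (\<Prod>i\<in>{1..k}. D i)" for n
    unfolding P_def prod_norm[symmetric] by (rule prod_mono) (simp add: D)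
  define Q where "Q = (\<Prod>i\<in>{1..k}. D i)"
  have "0 \<le> Q" using P[of undefined] norm_ge_zero[of "P undefined"] unfolding Q_def by linarith
  define R where "R = Q * (C * norm x * norm y)"
  have "0 \<le> R" using \<open>0 \<le> Q\<close> C(1) by (simp add: R_def)
  have "convergent (\<lambda>N. multi_avg k N (\<lambda>n. P n * cinner (W n (A (Suc j) (z n))) y))"
  proof (rule convergent_uniform_approximation)
    fix \<epsilon> :: real assume "0 < \<epsilon>"
    \<comment> \<open>An error \<delta> in \<open>A (Suc j)\<close> changes each summand by at most
      \<open>\<delta> * R\<close>, uniformly in \<open>n\<close>. The summand 1 covers
      \<open>R = 0\<close>.\<close>
    define \<delta> where "\<delta> = \<epsilon> / (R + 1)"
    have "0 < \<delta>" using \<open>0 < \<epsilon>\<close> \<open>0 \<le> R\<close> by (simp add: \<delta>_def)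
    obtain E u where "finite E"
      and Eu: "\<And>v. norm (A (Suc j) v - (\<Sum>e\<in>E. cinner v (u e) *\<^sub>C e)) \<le> \<delta> * norm v"
      using compact_operator_finite_rank_approximation[OF cpt \<open>0 < \<delta>\<close>] by blast
    define F where "F v = (\<Sum>e\<in>E. cinner v (u e) *\<^sub>C e)" for v
    define g where "g N = multi_avg k N (\<lambda>n. P n * cinner (W n (F (z n))) y)" for N
    have "P n * cinner (W n (F (z n))) y
        = (\<Sum>e\<in>E. P n * cinner (z n) (u e) * cinner (W n e) y)" for n
      by (simp add: F_def bounded_clinear_sum[OF W] bounded_clinear_scaleC[OF W] cinner_sum_left
          cinner_scaleC_left sum_distrib_left mult.assoc)
    then have g_eq: "g N = (\<Sum>e\<in>E. multi_avg k N (\<lambda>n. P n * cinner (z n) (u e) * cinner (W n e) y))"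
      for N
      by (simp add: g_def multi_avg_sum)
    have "convergent (\<lambda>N. multi_avg k N (\<lambda>n. P n * cinner (z n) (u e) * cinner (W n e) y))" for e
    proof -
      define i0 where "i0 = \<alpha> (Suc (Suc j))"
      define b where "b = a(i0 := \<lambda>n. a i0 n * cinner ((U ^^ n) x) (u e))"
      have b: "coefficient_sequence (b i)" if "i \<in> {1..k}" for i
        using Suc.prems(3)[OF that] coefficient_sequence_mult[OF _ U(2), of "a i" x "u e"]
        by (cases "i = i0") (simp_all add: b_def)
      have "(\<Prod>i\<in>{1..k}. b i (n i)) = P n * cinner (z n) (u e)" for n
        using prod_fun_upd_mult[OF finite_atLeastAtMost i0, of a "\<lambda>n. cinner ((U ^^ n) x) (u e)" n]
        by (simp only: b_def i0_def P_def z_def)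
      moreover have "convergent (\<lambda>N. multi_avg k N
          (\<lambda>n. (\<Prod>i\<in>{1..k}. b i (n i)) * cinner (entangled_word U A \<alpha> n j e) y))"
        using Suc.prems(1,2) b by (intro Suc.IH) auto
      ultimately show ?thesis by (simp add: W_def)
    qed
    then have "convergent g"
      unfolding g_eq[abs_def] by (rule convergent_sum)
    moreover have "cmod (multi_avg k N (\<lambda>n. P n * cinner (W n (A (Suc j) (z n))) y) - g N) \<le> \<epsilon>" for N
      unfolding g_def multi_avg_diff[symmetric]
    proof (rule norm_multi_avg_le)
      fix n
      have "norm (z n) = norm x"
        by (simp add: z_def norm_funpow_isometry norm_U)
      then have 1: "norm (A (Suc j) (z n) - F (z n)) \<le> \<delta> * norm x"
        using Eu[of "z n"] by (simp add: F_def)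
      have "cmod (cinner (W n (A (Suc j) (z n) - F (z n))) y)
          \<le> norm (W n (A (Suc j) (z n) - F (z n))) * norm y"
        by (rule Cauchy_Schwarz_cinner)
      also have "\<dots> \<le> (C * (\<delta> * norm x)) * norm y"
        by (intro mult_right_mono order_trans[OF C(2)] mult_left_mono 1 C(1)) simp
      finally have 2: "cmod (cinner (W n (A (Suc j) (z n) - F (z n))) y) \<le> C * (\<delta> * norm x) * norm y" .
      have "P n * cinner (W n (A (Suc j) (z n))) y - P n * cinner (W n (F (z n))) y
          = P n * cinner (W n (A (Suc j) (z n) - F (z n))) y"
        by (simp add: bounded_clinear_diff[OF W] cinner_diff_left right_diff_distrib)
      then have "cmod (P n * cinner (W n (A (Suc j) (z n))) y - P n * cinner (W n (F (z n))) y)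
          \<le> Q * (C * (\<delta> * norm x) * norm y)"
        unfolding norm_mult Q_def
        using mult_mono[OF P[of n] 2] \<open>0 \<le> Q\<close> by (simp add: norm_mult Q_def)
      also have "\<dots> = \<delta> * R" by (simp add: R_def)
      also have "\<dots> \<le> \<delta> * (R + 1)"
        using \<open>0 < \<delta>\<close> by (intro mult_left_mono) simp_all
      also have "\<dots> = \<epsilon>" using \<open>0 \<le> R\<close> by (simp add: \<delta>_def)
      finally show "cmod (P n * cinner (W n (A (Suc j) (z n))) y - P n * cinner (W n (F (z n))) y) \<le> \<epsilon>" .
    qed
    ultimately show "\<exists>g. convergent g \<and> (\<forall>N. cmod
        (multi_avg k N (\<lambda>n. P n * cinner (W n (A (Suc j) (z n))) y) - g N) \<le> \<epsilon>)"
      by blast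
  qed
  then show ?case by (simp add: P_def W_def z_def)
qed

section \<open>From convergence of matrix coefficients to a weak limit operator\<close>

lemma cinner_ergodic_average:
  "cinner (ergodic_average U A \<alpha> m k N x) y
    = multi_avg k N (\<lambda>n. cinner (entangled_word U A \<alpha> n (m - 1) x) y)"
  by (simp add: ergodic_average_def multi_avg_def cinner_scaleC_left cinner_sum_left)

theorem theorem2p6:
  fixes U :: "'a::chilbert_space \<Rightarrow> 'a"
    and A :: "nat \<Rightarrow> 'a \<Rightarrow> 'a"
    and \<alpha> :: "nat \<Rightarrow> nat"
    and m k :: nat
  assumes "unitary_operator U"
    and "1 \<le> k" and "k \<le> m"
    and "\<alpha> ` {1..m} = {1..k}"
    and "\<And>i. i \<in> {1..m - 1} \<Longrightarrow> compact_operator (A i)"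
  shows "\<exists>T. limitin weak_operator_topology (\<lambda>N. ergodic_average U A \<alpha> m k N) T sequentially"
proof -
  obtain V where U: "bounded_clinear U" and V: "is_adjoint V U" "V \<circ> U = id"
    using assms(1) by (auto simp: unitary_operator_def)
  have inner_U: "cinner (U x) (U y) = cinner x y" for x y
    using V(1) fun_cong[OF V(2), of y] by (simp add: is_adjoint_def)
  have norm_U: "norm (U x) = norm x" for x
    by (simp add: norm_eq_sqrt_cinner inner_U)
  have bA: "bounded_clinear (A i)" if "i \<in> {1..m - 1}" for i
    using assms(5)[OF that] by (simp add: compact_operator_def)
  \<comment> \<open>The word with index \<open>m - 1\<close> has \<open>m\<close> powers of
    \<open>U\<close>, because \<open>m\<close> is positive.\<close>
  have "Suc (m - 1) = m" using assms(2,3) by simp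
  then have \<alpha>: "\<alpha> i \<in> {1..k}" if "i \<in> {1..Suc (m - 1)}" for i
    using assms(4) that by auto
  define S where "S N = ergodic_average U A \<alpha> m k N" for N
  have word: "bounded_clinear (entangled_word U A \<alpha> n (m - 1))" for n
    using bounded_clinear_entangled_word[OF U bA] .
  obtain C where C: "C \<ge> 0" "\<And>n x. norm (entangled_word U A \<alpha> n (m - 1) x) \<le> C * norm x"
    using entangled_word_bound[where U = U and A = A and j = "m - 1" and \<alpha> = \<alpha>, OF norm_U bA]
    by auto
  have S_add: "S N (x + y) = S N x + S N y" for N x y
    by (simp only: S_def ergodic_average_def bounded_clinear_add[OF word] sum.distrib scaleC_add_right)
  have S_scaleC: "S N (c *\<^sub>C x) = c *\<^sub>C S N x" for N c x
    by (simp only: S_def ergodic_average_def bounded_clinear_scaleC[OF word] scaleC_sum_right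
        scaleC_scaleC mult.commute)
  have S_bound: "cmod (cinner (S N x) y) \<le> C * norm x * norm y" for N x y
    unfolding S_def cinner_ergodic_average
  proof (rule norm_multi_avg_le)
    fix n
    show "cmod (cinner (entangled_word U A \<alpha> n (m - 1) x) y) \<le> C * norm x * norm y"
      by (rule order_trans[OF Cauchy_Schwarz_cinner mult_right_mono[OF C(2) norm_ge_zero]])
  qed
  \<comment> \<open>Recovers an operator bound from a bound on the form by pairing an image vector
    with itself.\<close>
  have norm_le: "norm v \<le> norm x * C" if "cmod (cinner v v) \<le> C * norm x * norm v" for v x :: 'a
  proof (cases "v = 0")
    case False
    have "norm v * norm v \<le> (C * norm x) * norm v"
      using that by (simp add: cinner_self norm_power power2_eq_square norm_mult)
    then show ?thesis using False by (simp add: mult.commute)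
  qed (simp add: C(1))
  have S_clinear: "bounded_clinear (S N)" for N
    by (rule bounded_clinear_intro[where C = C]) (auto simp: S_add S_scaleC intro!: norm_le S_bound)
  have "convergent (\<lambda>N. cinner (S N x) y)" for x y
    using convergent_entangled_average[where a = "\<lambda>_ _. 1" and x = x and y = y,
        OF U inner_U assms(5) \<alpha> coefficient_sequence_one]
    by (simp add: S_def cinner_ergodic_average)
  then obtain L where L: "\<And>x y. (\<lambda>N. cinner (S N x) y) \<longlonglongrightarrow> L x y"
    unfolding convergent_def by metis
  have L_bound: "cmod (L x y) \<le> C * norm x * norm y" for x y
    using tendsto_norm[OF L[of x y]] by (rule LIMSEQ_le_const2) (use S_bound in blast)
  \<comment> \<open>\<open>L x\<close> is conjugate-linear in \<open>y\<close>; its conjugate is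
    linear, so Riesz provides the vector that becomes \<open>T x\<close>.\<close>
  have "\<exists>v. \<forall>y. cnj (L x y) = cinner y v" for x
  proof (rule Riesz_representation)
    show "cnj (L x (y + z)) = cnj (L x y) + cnj (L x z)" for y z
      using LIMSEQ_unique[OF L[of x "y + z"] tendsto_add[OF L[of x y] L[of x z],
          folded cinner_add_right]] by simp
    show "cnj (L x (c *\<^sub>C y)) = c * cnj (L x y)" for c y
      using LIMSEQ_unique[OF L[of x "c *\<^sub>C y"] tendsto_mult[OF tendsto_const[of "cnj c"] L[of x y],
          folded cinner_scaleC_right]] by simp
    show "cmod (cnj (L x y)) \<le> C * norm x * norm y" for y
      using L_bound by simp
  qed
  then obtain T where T: "\<And>x y. cnj (L x y) = cinner y (T x)" by metis
  have LT: "L x y = cinner (T x) y" for x y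
    using arg_cong[OF T[of x y], of cnj] cinner_commute[of "T x" y] by simp
  have eqI: "v = w" if "\<And>y. cinner v y = cinner w y" for v w :: 'a
  proof -
    have "cinner (v - w) (v - w) = 0" using that[of "v - w"] by (simp add: cinner_diff_left)
    then show ?thesis by (simp add: cinner_self)
  qed
  \<comment> \<open>Linearity is inherited from the averages by uniqueness of limits, and the bound
    by \<open>L_bound\<close> at \<open>y = T x\<close>.\<close>
  have "bounded_clinear T"
  proof (rule bounded_clinear_intro[where C = C])
    show "T (x + y) = T x + T y" for x y
    proof (rule eqI)
      fix z
      show "cinner (T (x + y)) z = cinner (T x + T y) z"
        using LIMSEQ_unique[OF L[of "x + y" z] tendsto_add[OF L[of x z] L[of y z],
            folded cinner_add_left S_add]] by (simp add: LT cinner_add_left)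
    qed
    show "T (c *\<^sub>C x) = c *\<^sub>C T x" for c x
    proof (rule eqI)
      fix z
      show "cinner (T (c *\<^sub>C x)) z = cinner (c *\<^sub>C T x) z"
        using LIMSEQ_unique[OF L[of "c *\<^sub>C x" z] tendsto_mult[OF tendsto_const[of c] L[of x z],
            folded cinner_scaleC_left S_scaleC]] by (simp add: LT cinner_scaleC_left)
    qed
    show "norm (T x) \<le> norm x * C" for x
      using L_bound[of x "T x"] by (intro norm_le) (simp only: LT)
  qed
  then have "limitin weak_operator_topology S T sequentially"
    unfolding limitin_weak_operator_topology using S_clinear L by (simp add: LT)
  then show ?thesis unfolding S_def by blast
qed

end
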